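(* Let $k$ be a field of characteristic zero. For every positive integer $n$, the following identity of formal power series in $t$ holds: \[ \sum_{h=0}^\infty \dim_k\left(k[\mathbf{x}^{(\leqslant h)}]/(\mathcal{I}_n^{\mathrm{Arc}}\cap k[\mathbf{x}^{(\leqslant h)}])\right)t^h=\frac{n+1}{1-(n+1)t}. \]
   Context: $k[\mathbf{x}^{(\infty)}]:=k[x_i^{(j)}\mid 1\leqslant i\leqslant n,\ j\geqslant 0]$ is the polynomial ring in the independent variables $x_i^{(j)}$ (formal derivatives of $x_i=x_i^{(0)}$), and $k[\mathbf{x}^{(\leqslant h)}]:=k[x_i^{(j)}\mid 1\leqslant i\leqslant n,\ 0\leqslant j\leqslant h]$. $\mathcal{I}_n=\langle x_ix_j\mid 1\leqslant i,j\leqslant n\rangle\subset k[x_1,\ldots,x_n]$. Put $x_i(t):=\sum_{j\geqslant 0}x_i^{(j)}t^j$ (no factorials). For an ideal $I\subset k[x_1,\ldots,x_n]$, $I^{\mathrm{Arc}}\subset k[\mathbf{x}^{(\infty)}]$ is the ideal generated by all coefficients with respect to $t$ of $f(x_1(t),\ldots,x_n(t))$, for all $f\in I$. In particular $\mathcal{I}_n^{\mathrm{Arc}}$ is generated by the polynomials $\sum_{s=0}^{\ell}x_i^{(s)}x_j^{(\ell-s)}$, $1\leqslant i\leqslant j\leqslant n$, $\ell\geqslant 0$. *)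

theory Defs
  imports
    "HOL-Library.Poly_Mapping"
    "HOL-Computational_Algebra.Formal_Power_Series"
    "HOL-Algebra.QuotRing"
    "HOL-Algebra.Embedded_Algebras"
begin

type_synonym ('v, 'k) mpoly = "('v \<Rightarrow>\<^sub>0 nat) \<Rightarrow>\<^sub>0 'k"

definition mvar :: "'v \<Rightarrow> ('v, 'k::comm_ring_1) mpoly"
  where "mvar v = Poly_Mapping.single (Poly_Mapping.single v 1) 1"

definition mconst :: "'k \<Rightarrow> ('v, 'k::comm_ring_1) mpoly"
  where "mconst c = Poly_Mapping.single 0 c"

definition mvars :: "('v, 'k::zero) mpoly \<Rightarrow> 'v set"
  where "mvars p = (\<Union>m\<in>Poly_Mapping.keys p. Poly_Mapping.keys m)"

(* The polynomial ring k[V], as a subring of the polynomials in all variables of type 'v. *)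
definition poly_ring :: "'v set \<Rightarrow> ('v, 'k::comm_ring_1) mpoly ring"
  where "poly_ring V =
    \<lparr>carrier = {p. mvars p \<subseteq> V}, mult = (*), one = 1, zero = 0, add = (+)\<rparr>"

(* The pair (i, j) stands for the variable x_i^(j), and i alone for x_i. *)

definition jet_vars :: "nat \<Rightarrow> nat \<Rightarrow> (nat \<times> nat) set"
  where "jet_vars n h = {1..n} \<times> {0..h}"

definition arc_vars :: "nat \<Rightarrow> (nat \<times> nat) set"
  where "arc_vars n = {1..n} \<times> UNIV"

(* x_i(t), without factorials *)
definition arc_series :: "nat \<Rightarrow> (nat \<times> nat, 'k::comm_ring_1) mpoly fps"
  where "arc_series i = Abs_fps (\<lambda>j. mvar (i, j))"

(* f(x_1(t), ..., x_n(t)) *)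
definition arc_subst :: "(nat, 'k::comm_ring_1) mpoly \<Rightarrow> (nat \<times> nat, 'k) mpoly fps"
  where "arc_subst f =
    (\<Sum>m\<in>Poly_Mapping.keys f. fps_const (mconst (Poly_Mapping.lookup f m)) *
       (\<Prod>i\<in>Poly_Mapping.keys m. arc_series i ^ Poly_Mapping.lookup m i))"

definition arc_ideal ::
    "nat \<Rightarrow> (nat, 'k::comm_ring_1) mpoly set \<Rightarrow> (nat \<times> nat, 'k) mpoly set"
  where "arc_ideal n I =
    Idl\<^bsub>poly_ring (arc_vars n)\<^esub> {fps_nth (arc_subst f) l | f l. f \<in> I}"

(* The ideal I_n of the fat point. *)
definition fat_point_ideal :: "nat \<Rightarrow> (nat, 'k::comm_ring_1) mpoly set"
  where "fat_point_ideal n =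
    Idl\<^bsub>poly_ring {1..n}\<^esub> {mvar i * mvar j | i j. i \<in> {1..n} \<and> j \<in> {1..n}}"

(* The dimension over k of k[V]/J for a proper ideal J.  The library measures dimension over a
   subfield of the ring at hand, here the image of k in the quotient. If the dimension is
   infinite, ring.dim is an unspecified natural number. *)
definition quot_dim :: "'v set \<Rightarrow> ('v, 'k::field) mpoly set \<Rightarrow> nat"
  where "quot_dim V J =
    ring.dim (poly_ring V Quot J)
      (range (\<lambda>c. J +>\<^bsub>poly_ring V\<^esub> mconst c))
      (carrier (poly_ring V Quot J))"

end

theory Submission
  imports Defs "HOL-Combinatorics.Permutations" "HOL-Computational_Algebra.Polynomial"
begin

text \<open>
Write \<open>x\<^sub>i(t)\<close> for the generic arcs, \<open>I\<close> for the arc ideal and \<open>N = h + 1\<close>. It has to be shown that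
the algebra \<open>A\<close> generated by the \<open>x\<^sub>i\<^sup>(\<^sup>j\<^sup>)\<close>, \<open>j < N\<close>, inside the quotient by \<open>I\<close> has dimension
\<open>(n + 1) ^ N\<close>. This is the dimension of the \<open>N\<close>-fold tensor power of the algebra \<open>k[y\<^sub>1, \<dots>, y\<^sub>n] / (y\<^sub>i y\<^sub>j)\<close>
of the fat point, which enters through a deformation of the generators of \<open>A\<close>.

\<^emph>\<open>At most.\<close> Let \<open>\<epsilon>\<close> be a formal parameter and evaluate the arcs at the points \<open>p \<epsilon>\<close>, \<open>p < N\<close>.
Modulo \<open>I\<close> we have \<open>x\<^sub>i(p \<epsilon>) x\<^sub>j(p \<epsilon>) = 0\<close>, so the algebra generated by these values is spanned
by the \<open>(n + 1) ^ N\<close> products that take at most one value at each point. By interpolation, a suitable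
constant linear combination of the values \<open>x\<^sub>i(p \<epsilon>)\<close> equals \<open>\<epsilon> ^ j (x\<^sub>i\<^sup>(\<^sup>j\<^sup>) + O(\<epsilon>))\<close>
(\<open>inverse_vandermonde\<close>). Hence any \<open>(n + 1) ^ N + 1\<close> polynomials in the \<open>x\<^sub>i\<^sup>(\<^sup>j\<^sup>)\<close>, evaluated at these
deformed variables, are linearly dependent over the power series in \<open>\<epsilon>\<close>. Cancelling a power
of \<open>\<epsilon>\<close> from the coefficients and then putting \<open>\<epsilon> = 0\<close> leaves a linear dependence over \<open>k\<close>
modulo \<open>I\<close> (\<open>linearly_dependent_mod_arc_ideal\<close>).

\<^emph>\<open>At least.\<close> For variables \<open>x\<close> with index \<open>i\<^sub>r\<close> and orders \<open>a\<^sub>r + s\<close>, where \<open>r, s < d\<close>, consider the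
functional that applies the determinant of the matrix of derivations \<open>\<partial> / \<partial> x\<close> to a polynomial and
takes the value at the origin. It vanishes on \<open>I\<close>: the two factors of a generator, a coefficient of
\<open>x\<^sub>i(t) x\<^sub>j(t)\<close>, are hit by two rows of the determinant, and exchanging the columns chosen in these
two rows changes the sign but not the contribution
(\<open>alternating_functional_arc_product\<close>). The monomials of the following kind are triangular with
respect to these functionals: list the variables by increasing index \<open>i\<close>, and by decreasing order
for equal \<open>i\<close>; then the variable in place \<open>r\<close> (counted from 0) must have order at least \<open>r\<close> and
at most \<open>h\<close>. The triangularity is a form of the rearrangement inequality: among the monomials in the
expansion of the determinant, the identity permutation yields the most balanced one
(\<open>sum_permutation_greater\<close>, \<open>normal_words_independent\<close>). Finally there are exactly \<open>(n + 1) ^ N\<close>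
such monomials (\<open>card_normal_words\<close>), so they form a basis of \<open>A\<close>.
\<close>

section \<open>Polynomials and their monomials\<close>

lemma mvars_add: "mvars (p + q) \<subseteq> mvars p \<union> mvars q"
  unfolding mvars_def using keys_add[of p q] by blast

lemma mvars_mult: "mvars (p * q) \<subseteq> mvars p \<union> mvars q"
proof
  fix v assume "v \<in> mvars (p * q)"
  then obtain m where m: "m \<in> Poly_Mapping.keys (p * q)" "v \<in> Poly_Mapping.keys m"
    by (auto simp: mvars_def)
  then obtain a b where "a \<in> Poly_Mapping.keys p" "b \<in> Poly_Mapping.keys q" "m = a + b"
    using keys_mult[of p q] by blast
  then show "v \<in> mvars p \<union> mvars q"
    using m(2) keys_add[of a b] by (auto simp: mvars_def)
qed

lemma mvars_uminus [simp]: "mvars (- p) = mvars p"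
  for p :: "('v, 'k::comm_ring_1) mpoly"
  unfolding mvars_def by (simp add: keys_def)

lemma mvars_0 [simp]: "mvars 0 = {}"
  unfolding mvars_def by simp

lemma mvars_mconst [simp]: "mvars (mconst c) = {}"
  unfolding mvars_def mconst_def by simp

lemma mvars_1 [simp]: "mvars (1 :: ('v, 'k::comm_ring_1) mpoly) = {}"
  unfolding mvars_def by simp

lemma mvars_mvar [simp]: "mvars (mvar v :: ('v, 'k::comm_ring_1) mpoly) = {v}"
  unfolding mvars_def mvar_def by simp

lemma mconst_add: "mconst (a + b) = mconst a + mconst b"
  unfolding mconst_def by (simp add: single_add)

lemma mconst_mult: "mconst (a * b) = mconst a * mconst b"
  unfolding mconst_def by (simp add: mult_single)

lemma mconst_0 [simp]: "mconst 0 = 0"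
  unfolding mconst_def by simp

lemma mconst_1 [simp]: "mconst 1 = 1"
  unfolding mconst_def by simp

lemma mconst_sum: "mconst (sum f A) = (\<Sum>x\<in>A. mconst (f x))"
  by (induction A rule: infinite_finite_induct) (simp_all add: mconst_add)

lemma mconst_uminus: "mconst (- c) = - mconst c"
  by (simp add: mconst_def single_uminus)

lemma lookup_monomial_mult:
  "Poly_Mapping.lookup (Poly_Mapping.single a c * F) (a + m) = c * Poly_Mapping.lookup F m"
  for a m :: "'v \<Rightarrow>\<^sub>0 nat" and F :: "('v, 'k::comm_ring_1) mpoly"
  by (simp add: lookup_mult lookup_single when_mult)

lemma lookup_monomial_mult_eq_0:
  fixes a m :: "'v \<Rightarrow>\<^sub>0 nat" and F :: "('v, 'k::comm_ring_1) mpoly"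
  assumes "\<And>m'. m \<noteq> a + m'"
  shows "Poly_Mapping.lookup (Poly_Mapping.single a c * F) m = 0"
  using assms by (simp add: lookup_mult lookup_single when_mult)

lemma mpoly_eq_sum_monomials:
  "F = (\<Sum>m\<in>Poly_Mapping.keys F. Poly_Mapping.single m (Poly_Mapping.lookup F m))"
  by (rule poly_mapping_eqI)
     (auto simp: lookup_sum lookup_single when_def in_keys_iff)

lemma prod_mvar_power:
  assumes "finite A"
  shows "(\<Prod>v\<in>A. mvar v ^ e v) =
    (Poly_Mapping.single (\<Sum>v\<in>A. Poly_Mapping.single v (e v)) 1 :: ('v, 'k::comm_ring_1) mpoly)"
proof -
  have pow: "mvar v ^ k = (Poly_Mapping.single (Poly_Mapping.single v k) 1 :: ('v, 'k) mpoly)"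
    for v k
    by (induction k) (simp_all add: mvar_def mult_single single_add[symmetric])
  show ?thesis
    using assms by (induction A rule: finite_induct) (simp_all add: pow mult_single)
qed

lemma monomial_eq_prod:
  "Poly_Mapping.single m c =
    mconst c * (\<Prod>v\<in>Poly_Mapping.keys m. mvar v ^ Poly_Mapping.lookup m v)"
  for m :: "'v \<Rightarrow>\<^sub>0 nat" and c :: "'k::comm_ring_1"
proof -
  have "(\<Sum>v\<in>Poly_Mapping.keys m. Poly_Mapping.single v (Poly_Mapping.lookup m v)) = m"
    by (rule poly_mapping_eqI) (auto simp: lookup_sum lookup_single when_def in_keys_iff)
  then show ?thesis
    by (simp add: prod_mvar_power mconst_def mult_single)
qed

definition monomial_value :: "('v \<Rightarrow> 'a::comm_monoid_mult) \<Rightarrow> ('v \<Rightarrow>\<^sub>0 nat) \<Rightarrow> 'a"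
  where "monomial_value x m = (\<Prod>v\<in>Poly_Mapping.keys m. x v ^ Poly_Mapping.lookup m v)"

text \<open>The product may run over any finite set that contains the variables of the monomial, so that several
monomials can be compared over a common index set.\<close>
lemma monomial_value_superset:
  assumes "finite A" "Poly_Mapping.keys m \<subseteq> A"
  shows "monomial_value x m = (\<Prod>v\<in>A. x v ^ Poly_Mapping.lookup m v)"
  unfolding monomial_value_def
  by (rule prod.mono_neutral_left) (use assms in \<open>auto simp: in_keys_iff\<close>)

lemma monomial_value_add: "monomial_value x (a + b) = monomial_value x a * monomial_value x b"
proof -
  let ?A = "Poly_Mapping.keys a \<union> Poly_Mapping.keys b"
  have "Poly_Mapping.keys (a + b) \<subseteq> ?A"
    by (rule keys_add)
  then show ?thesis
    by (simp add: monomial_value_superset[of ?A] lookup_add power_add prod.distrib)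
qed

lemma monomial_value_single [simp]: "monomial_value x (Poly_Mapping.single v k) = x v ^ k"
  by (simp add: monomial_value_def)

lemma monomial_value_mvar: "mconst c * monomial_value mvar m = Poly_Mapping.single m c"
  unfolding monomial_value_def by (rule monomial_eq_prod[symmetric])

lemma poly_ring_simps [simp]:
  "carrier (poly_ring V) = {p. mvars p \<subseteq> V}"
  "mult (poly_ring V) = (*)" "one (poly_ring V) = 1"
  "zero (poly_ring V) = 0" "add (poly_ring V) = (+)"
  by (simp_all add: poly_ring_def)

lemma poly_ring_cring: "cring (poly_ring V :: ('v, 'k::comm_ring_1) mpoly ring)"
proof (rule cringI)
  show "abelian_group (poly_ring V :: ('v, 'k) mpoly ring)"
  proof (rule abelian_groupI)
    fix x :: "('v, 'k) mpoly"
    assume "x \<in> carrier (poly_ring V)"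
    then show "\<exists>y\<in>carrier (poly_ring V). y \<oplus>\<^bsub>poly_ring V\<^esub> x = \<zero>\<^bsub>poly_ring V\<^esub>"
      by (intro bexI[of _ "- x"]) auto
  qed (use mvars_add in \<open>fastforce simp: add_ac\<close>)+
  show "Group.comm_monoid (poly_ring V :: ('v, 'k) mpoly ring)"
    by (rule comm_monoidI) (use mvars_mult in \<open>fastforce simp: mult_ac\<close>)+
qed (auto simp: algebra_simps)

lemma poly_ring_a_inv:
  assumes "mvars p \<subseteq> V"
  shows "\<ominus>\<^bsub>poly_ring V\<^esub> p = - (p :: ('v, 'k::comm_ring_1) mpoly)"
proof -
  interpret cring "poly_ring V :: ('v, 'k) mpoly ring"
    by (rule poly_ring_cring)
  show ?thesis
    using assms by (intro minus_equality) auto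
qed

text \<open>Closure under negation is multiplication by the constant \<open>- 1\<close>.\<close>
lemma ideal_poly_ringI:
  fixes I :: "('v, 'k::comm_ring_1) mpoly set"
  assumes "\<And>p. p \<in> I \<Longrightarrow> mvars p \<subseteq> V" and "0 \<in> I"
    and "\<And>p q. p \<in> I \<Longrightarrow> q \<in> I \<Longrightarrow> p + q \<in> I"
    and "\<And>a p. mvars a \<subseteq> V \<Longrightarrow> p \<in> I \<Longrightarrow> a * p \<in> I"
  shows "ideal I (poly_ring V)"
proof -
  interpret cring "poly_ring V :: ('v, 'k) mpoly ring"
    by (rule poly_ring_cring)
  have "- p \<in> I" if "p \<in> I" for p
    using assms(4)[of "- 1" p] that by simp
  moreover have "p * a \<in> I" if "p \<in> I" "mvars a \<subseteq> V" for a p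
    using assms(4)[OF that(2,1)] by (simp add: mult.commute)
  moreover have "I \<subseteq> {p. mvars p \<subseteq> V}"
    using assms(1) by blast
  ultimately show ?thesis
    using assms
    by (intro idealI ring_axioms add.subgroupI) (auto simp: poly_ring_a_inv a_inv_def[symmetric] subset_iff)
qed

lemma sum_mem:
  assumes "0 \<in> I" "\<And>p q. p \<in> I \<Longrightarrow> q \<in> I \<Longrightarrow> p + q \<in> I" "\<And>x. x \<in> A \<Longrightarrow> f x \<in> I"
  shows "(sum f A :: 'a::comm_monoid_add) \<in> I"
  using assms by (induction A rule: infinite_finite_induct) auto

lemma mvars_sum:
  assumes "\<And>x. x \<in> A \<Longrightarrow> mvars (f x) \<subseteq> V"
  shows "mvars (sum f A) \<subseteq> V"
proof -
  have "p + q \<in> {p. mvars p \<subseteq> V}" if "p \<in> {p. mvars p \<subseteq> V}" "q \<in> {p. mvars p \<subseteq> V}" for p q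
    using that mvars_add[of p q] by blast
  then have "sum f A \<in> {p. mvars p \<subseteq> V}"
    using assms by (intro sum_mem) auto
  then show ?thesis by simp
qed

section \<open>Power series with restricted coefficients\<close>

definition coeffs_in :: "'a set \<Rightarrow> 'a::zero fps set"
  where "coeffs_in A = {F. \<forall>l. fps_nth F l \<in> A}"

lemma coeffs_in_mult:
  fixes F G :: "'a::comm_ring_1 fps"
  assumes "0 \<in> I" "\<And>p q. p \<in> I \<Longrightarrow> q \<in> I \<Longrightarrow> p + q \<in> I"
    and "\<And>a p. a \<in> R \<Longrightarrow> p \<in> I \<Longrightarrow> a * p \<in> I"
    and "F \<in> coeffs_in R" "G \<in> coeffs_in I"
  shows "F * G \<in> coeffs_in I"
  using assms(3-5) unfolding coeffs_in_def
  by (auto simp: fps_mult_nth intro!: sum_mem[OF assms(1,2)])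

lemma coeffs_in_sum:
  assumes "0 \<in> I" "\<And>p q. p \<in> I \<Longrightarrow> q \<in> I \<Longrightarrow> p + q \<in> I" "\<And>x. x \<in> A \<Longrightarrow> f x \<in> coeffs_in I"
  shows "(sum f A :: 'a::comm_monoid_add fps) \<in> coeffs_in I"
  using assms(3) unfolding coeffs_in_def
  by (auto simp: fps_sum_nth intro!: sum_mem[OF assms(1,2)])

lemma coeffs_in_vars_mult:
  fixes F G :: "('v, 'k::comm_ring_1) mpoly fps"
  assumes "F \<in> coeffs_in {p. mvars p \<subseteq> V}" "G \<in> coeffs_in {p. mvars p \<subseteq> V}"
  shows "F * G \<in> coeffs_in {p. mvars p \<subseteq> V}"
proof (rule coeffs_in_mult[OF _ _ _ assms])
  fix p q :: "('v, 'k) mpoly"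
  assume "p \<in> {p. mvars p \<subseteq> V}" "q \<in> {p. mvars p \<subseteq> V}"
  then show "p + q \<in> {p. mvars p \<subseteq> V}" "p * q \<in> {p. mvars p \<subseteq> V}"
    using mvars_add[of p q] mvars_mult[of p q] by blast+
qed simp

lemma coeffs_in_vars_prod:
  assumes "\<And>x. x \<in> A \<Longrightarrow> f x \<in> coeffs_in {p. mvars p \<subseteq> V}"
  shows "(prod f A :: ('v, 'k::comm_ring_1) mpoly fps) \<in> coeffs_in {p. mvars p \<subseteq> V}"
proof -
  have one: "1 \<in> coeffs_in {p :: ('v, 'k) mpoly. mvars p \<subseteq> V}"
    by (auto simp: coeffs_in_def)
  show ?thesis
    using assms
    by (induction A rule: infinite_finite_induct) (auto intro: one coeffs_in_vars_mult)
qed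

lemma coeffs_in_vars_power:
  fixes F :: "('v, 'k::comm_ring_1) mpoly fps"
  shows "F \<in> coeffs_in {p. mvars p \<subseteq> V} \<Longrightarrow> F ^ k \<in> coeffs_in {p. mvars p \<subseteq> V}"
  using coeffs_in_vars_prod[of "{..<k}" "\<lambda>_. F" V] by simp

section \<open>The arc ideal of the fat point\<close>

text \<open>Polynomials all of whose monomials are divisible by a product of two variables form an ideal that
contains the generators.\<close>
lemma fat_point_ideal_monomials:
  assumes "f \<in> fat_point_ideal n"
  shows "mvars f \<subseteq> {1..n}"
    and "m \<in> Poly_Mapping.keys f \<Longrightarrow>
      \<exists>i j m'. m = Poly_Mapping.single i 1 + Poly_Mapping.single j 1 + m'"
proof -
  interpret cring "poly_ring {1..n} :: (nat, 'a) mpoly ring"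
    by (rule poly_ring_cring)
  let ?P = "\<lambda>m. \<exists>i j m'. m = Poly_Mapping.single i (1::nat) + Poly_Mapping.single j 1 + m'"
  let ?J = "{f :: (nat, 'a) mpoly. mvars f \<subseteq> {1..n} \<and> (\<forall>m\<in>Poly_Mapping.keys f. ?P m)}"
  have "ideal ?J (poly_ring {1..n})"
  proof (rule ideal_poly_ringI)
    fix p q :: "(nat, 'a) mpoly"
    assume "p \<in> ?J" "q \<in> ?J"
    then show "p + q \<in> ?J"
      using mvars_add[of p q] keys_add[of p q] by blast
  next
    fix a p :: "(nat, 'a) mpoly"
    assume a: "mvars a \<subseteq> {1..n}" and p: "p \<in> ?J"
    have "?P m" if m: "m \<in> Poly_Mapping.keys (a * p)" for m
    proof -
      obtain m1 m2 where m12: "m = m1 + m2" "m2 \<in> Poly_Mapping.keys p"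
        using keys_mult[of a p] m by blast
      then obtain i j m' where "m2 = Poly_Mapping.single i 1 + Poly_Mapping.single j 1 + m'"
        using p by blast
      then have "m = Poly_Mapping.single i 1 + Poly_Mapping.single j 1 + (m1 + m')"
        using m12 by (simp add: add_ac)
      then show ?thesis by blast
    qed
    then show "a * p \<in> ?J"
      using a p mvars_mult[of a p] by blast
  qed auto
  moreover have "mvar i * mvar j \<in> ?J" if "i \<in> {1..n}" "j \<in> {1..n}" for i j
  proof -
    have eq: "mvar i * mvar j =
        (Poly_Mapping.single (Poly_Mapping.single i 1 + Poly_Mapping.single j 1) 1 :: (nat, 'a) mpoly)"
      by (simp add: mvar_def mult_single)
    have "?P m" if "m \<in> Poly_Mapping.keys (mvar i * mvar j :: (nat, 'a) mpoly)" for m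
    proof -
      have "m = Poly_Mapping.single i 1 + Poly_Mapping.single j 1 + 0"
        using that unfolding eq by simp
      then show ?thesis by blast
    qed
    then show ?thesis
      using that mvars_mult[of "mvar i :: (nat, 'a) mpoly" "mvar j"] by auto
  qed
  ultimately have "fat_point_ideal n \<subseteq> ?J"
    unfolding fat_point_ideal_def by (intro genideal_minimal) auto
  then show "mvars f \<subseteq> {1..n}" and "m \<in> Poly_Mapping.keys f \<Longrightarrow> ?P m"
    using assms by blast+
qed

lemma arc_subst_eq:
  "arc_subst f = (\<Sum>m\<in>Poly_Mapping.keys f.
     fps_const (mconst (Poly_Mapping.lookup f m)) * monomial_value arc_series m)"
  unfolding arc_subst_def monomial_value_def ..

text \<open>Every monomial of \<open>f\<close> is divisible by a product of two variables, so its value at the generic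
arcs is a multiple of some \<open>x\<^sub>p(t) x\<^sub>q(t)\<close>. Thus a set that is closed under addition and under
multiplication by polynomials and contains the coefficients of these products contains all generators
of the arc ideal.\<close>
lemma arc_subst_coeffs_in:
  fixes I :: "(nat \<times> nat, 'k::comm_ring_1) mpoly set"
  assumes "0 \<in> I" "\<And>p q. p \<in> I \<Longrightarrow> q \<in> I \<Longrightarrow> p + q \<in> I"
    and "\<And>a p. p \<in> I \<Longrightarrow> a * p \<in> I"
    and "\<And>p q l. fps_nth (arc_series p * arc_series q) l \<in> I"
    and "f \<in> fat_point_ideal n"
  shows "arc_subst f \<in> coeffs_in I"
  unfolding arc_subst_eq
proof (rule coeffs_in_sum)
  fix m assume "m \<in> Poly_Mapping.keys f"
  then obtain i j m' where m: "m = Poly_Mapping.single i 1 + Poly_Mapping.single j 1 + m'"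
    using fat_point_ideal_monomials(2)[OF assms(5)] by blast
  have "fps_const (mconst (Poly_Mapping.lookup f m)) * monomial_value arc_series m' *
      (arc_series i * arc_series j) \<in> coeffs_in I"
    by (rule coeffs_in_mult[where R = UNIV]) (use assms in \<open>auto simp: coeffs_in_def\<close>)
  then show "fps_const (mconst (Poly_Mapping.lookup f m)) * monomial_value arc_series m \<in> coeffs_in I"
    by (simp add: m monomial_value_add mult_ac)
qed (use assms in auto)

lemma arc_series_coeffs_in:
  "i \<in> {1..n} \<Longrightarrow> arc_series i \<in> coeffs_in {p. mvars p \<subseteq> arc_vars n}"
  by (auto simp: coeffs_in_def arc_series_def arc_vars_def)

lemma arc_subst_coeffs_in_vars:
  assumes "f \<in> fat_point_ideal n"
  shows "arc_subst f \<in> coeffs_in {p :: (nat \<times> nat, 'k::comm_ring_1) mpoly. mvars p \<subseteq> arc_vars n}"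
  unfolding arc_subst_eq
proof (rule coeffs_in_sum)
  fix m assume m: "m \<in> Poly_Mapping.keys f"
  have "Poly_Mapping.keys m \<subseteq> {1..n}"
    using m fat_point_ideal_monomials(1)[OF assms] by (auto simp: mvars_def)
  moreover have "fps_const (mconst c) \<in> coeffs_in {p :: (nat \<times> nat, 'k) mpoly. mvars p \<subseteq> arc_vars n}"
    for c by (simp add: coeffs_in_def fps_const_def)
  ultimately show "fps_const (mconst (Poly_Mapping.lookup f m)) * monomial_value arc_series m
      \<in> coeffs_in {p :: (nat \<times> nat, 'k) mpoly. mvars p \<subseteq> arc_vars n}"
    unfolding monomial_value_def
    by (intro coeffs_in_vars_mult coeffs_in_vars_prod coeffs_in_vars_power arc_series_coeffs_in) auto
next
  fix p q :: "(nat \<times> nat, 'k) mpoly"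
  assume "p \<in> {p. mvars p \<subseteq> arc_vars n}" "q \<in> {p. mvars p \<subseteq> arc_vars n}"
  then show "p + q \<in> {p. mvars p \<subseteq> arc_vars n}"
    using mvars_add[of p q] by blast
qed simp

abbreviation fat_point_arc_ideal :: "nat \<Rightarrow> (nat \<times> nat, 'k::comm_ring_1) mpoly set"
  where "fat_point_arc_ideal n \<equiv> arc_ideal n (fat_point_ideal n)"

lemma fat_point_arc_ideal_generators_subset:
  "{fps_nth (arc_subst f) l | f l. f \<in> fat_point_ideal n} \<subseteq>
     carrier (poly_ring (arc_vars n) :: (nat \<times> nat, 'k::comm_ring_1) mpoly ring)"
proof -
  have "mvars (fps_nth (arc_subst f) l) \<subseteq> arc_vars n" if "f \<in> fat_point_ideal n"
    for f :: "(nat, 'k) mpoly" and l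
    using arc_subst_coeffs_in_vars[OF that] by (simp add: coeffs_in_def)
  then show ?thesis by auto
qed

lemma ideal_fat_point_arc_ideal:
  "ideal (fat_point_arc_ideal n :: (nat \<times> nat, 'k::comm_ring_1) mpoly set) (poly_ring (arc_vars n))"
proof -
  interpret cring "poly_ring (arc_vars n) :: (nat \<times> nat, 'k) mpoly ring"
    by (rule poly_ring_cring)
  show ?thesis
    unfolding arc_ideal_def
    by (rule genideal_ideal[OF fat_point_arc_ideal_generators_subset])
qed

lemma fat_point_arc_ideal_closed:
  fixes p q a :: "(nat \<times> nat, 'k::comm_ring_1) mpoly"
  shows "0 \<in> (fat_point_arc_ideal n :: (nat \<times> nat, 'k) mpoly set)"
    and "p \<in> fat_point_arc_ideal n \<Longrightarrow> q \<in> fat_point_arc_ideal n \<Longrightarrow> p + q \<in> fat_point_arc_ideal n"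
    and "mvars a \<subseteq> arc_vars n \<Longrightarrow> p \<in> fat_point_arc_ideal n \<Longrightarrow> a * p \<in> fat_point_arc_ideal n"
    and "p \<in> fat_point_arc_ideal n \<Longrightarrow> mvars p \<subseteq> arc_vars n"
proof -
  interpret ideal "fat_point_arc_ideal n :: (nat \<times> nat, 'k) mpoly set" "poly_ring (arc_vars n)"
    by (rule ideal_fat_point_arc_ideal)
  show "0 \<in> (fat_point_arc_ideal n :: (nat \<times> nat, 'k) mpoly set)"
    using additive_subgroup.zero_closed[OF is_additive_subgroup] by simp
  show "p \<in> fat_point_arc_ideal n \<Longrightarrow> q \<in> fat_point_arc_ideal n \<Longrightarrow> p + q \<in> fat_point_arc_ideal n"
    using additive_subgroup.a_closed[OF is_additive_subgroup, of p q] by simp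
  show "mvars a \<subseteq> arc_vars n \<Longrightarrow> p \<in> fat_point_arc_ideal n \<Longrightarrow> a * p \<in> fat_point_arc_ideal n"
    using I_l_closed[of p a] by simp
  show "p \<in> fat_point_arc_ideal n \<Longrightarrow> mvars p \<subseteq> arc_vars n"
    using Icarr[of p] by simp
qed

lemma fat_point_arc_ideal_sum:
  "(\<And>x. x \<in> A \<Longrightarrow> f x \<in> fat_point_arc_ideal n) \<Longrightarrow>
     (sum f A :: (nat \<times> nat, 'k::comm_ring_1) mpoly) \<in> fat_point_arc_ideal n"
  by (rule sum_mem) (auto intro: fat_point_arc_ideal_closed)

lemma arc_product_in_fat_point_arc_ideal:
  assumes "i \<in> {1..n}" "j \<in> {1..n}"
  shows "fps_nth (arc_series i * arc_series j) l \<in>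
    (fat_point_arc_ideal n :: (nat \<times> nat, 'k::comm_ring_1) mpoly set)"
proof -
  interpret cring "poly_ring (arc_vars n) :: (nat \<times> nat, 'k) mpoly ring"
    by (rule poly_ring_cring)
  interpret F: cring "poly_ring {1..n} :: (nat, 'k) mpoly ring"
    by (rule poly_ring_cring)
  let ?f = "mvar i * mvar j :: (nat, 'k) mpoly"
  let ?m = "Poly_Mapping.single i 1 + Poly_Mapping.single j (1::nat)"
  have "{mvar i * mvar j | i j. i \<in> {1..n} \<and> j \<in> {1..n}} \<subseteq>
      carrier (poly_ring {1..n} :: (nat, 'k) mpoly ring)"
    using mvars_mult by fastforce
  then have f: "?f \<in> fat_point_ideal n"
    unfolding fat_point_ideal_def using assms F.genideal_self by blast
  have eq: "?f = Poly_Mapping.single ?m 1"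
    by (simp add: mvar_def mult_single)
  have "arc_subst ?f = arc_series i * arc_series j"
    unfolding arc_subst_eq eq by (simp add: monomial_value_add del: One_nat_def)
  moreover have "fps_nth (arc_subst ?f) l \<in> fat_point_arc_ideal n"
    unfolding arc_ideal_def
    using genideal_self[OF fat_point_arc_ideal_generators_subset] f by blast
  ultimately show ?thesis by simp
qed

section \<open>Determinants of derivations\<close>

definition index_monomial :: "('r \<Rightarrow> 'v) \<Rightarrow> 'r set \<Rightarrow> 'v \<Rightarrow>\<^sub>0 nat"
  where "index_monomial f S = (\<Sum>r\<in>S. Poly_Mapping.single (f r) 1)"

lemma lookup_index_monomial:
  "finite S \<Longrightarrow> Poly_Mapping.lookup (index_monomial f S) v = card {r \<in> S. f r = v}"
  by (auto simp: index_monomial_def lookup_sum lookup_single when_def sum.If_cases Int_def)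

text \<open>This is \<open>((\<Prod>\<^sub>r\<^sub>\<in>\<^sub>S \<partial> / \<partial> x\<^sub>f\<^sub>(\<^sub>r\<^sub>)) F)(0)\<close>: only the monomial \<open>\<Prod>\<^sub>r x\<^sub>f\<^sub>(\<^sub>r\<^sub>)\<close> of \<open>F\<close> survives, and
the iterated derivative multiplies its coefficient by the factorials of the exponents.\<close>
definition deriv_at_0 :: "('r \<Rightarrow> 'v) \<Rightarrow> 'r set \<Rightarrow> ('v, 'k::field_char_0) mpoly \<Rightarrow> 'k"
  where "deriv_at_0 f S F =
    (\<Prod>v\<in>Poly_Mapping.keys (index_monomial f S).
       fact (Poly_Mapping.lookup (index_monomial f S) v)) *
    Poly_Mapping.lookup F (index_monomial f S)"

lemma deriv_at_0_add: "deriv_at_0 f S (F + G) = deriv_at_0 f S F + deriv_at_0 f S G"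
  by (simp add: deriv_at_0_def lookup_add algebra_simps)

lemma deriv_at_0_0 [simp]: "deriv_at_0 f S 0 = 0"
  by (simp add: deriv_at_0_def)

lemma deriv_at_0_sum: "deriv_at_0 f S (sum G A) = (\<Sum>x\<in>A. deriv_at_0 f S (G x))"
  by (induction A rule: infinite_finite_induct) (simp_all add: deriv_at_0_add)

text \<open>The factorials \<open>\<Prod>\<^sub>v m\<^sub>v!\<close> that turn coefficients into values of derivatives grow by the new
exponent of \<open>v\<close> when the monomial is multiplied by \<open>v\<close>.\<close>
lemma prod_fact_single_add:
  fixes m :: "'v \<Rightarrow>\<^sub>0 nat"
  shows "(\<Prod>w\<in>Poly_Mapping.keys (Poly_Mapping.single v 1 + m).
            fact (Poly_Mapping.lookup (Poly_Mapping.single v 1 + m) w)) =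
         (of_nat (Suc (Poly_Mapping.lookup m v)) *
          (\<Prod>w\<in>Poly_Mapping.keys m. fact (Poly_Mapping.lookup m w)) :: 'k::field_char_0)"
proof -
  let ?A = "insert v (Poly_Mapping.keys m)"
  have A: "(\<Prod>w\<in>Poly_Mapping.keys m'. fact (Poly_Mapping.lookup m' w)) =
      (\<Prod>w\<in>?A. fact (Poly_Mapping.lookup m' w) :: 'k)" 
    if "Poly_Mapping.keys m' \<subseteq> ?A" for m' :: "'v \<Rightarrow>\<^sub>0 nat"
    by (rule prod.mono_neutral_left) (use that in \<open>auto simp: in_keys_iff\<close>)
  have B: "Poly_Mapping.keys (Poly_Mapping.single v 1 + m) \<subseteq> ?A"
    using keys_add[of "Poly_Mapping.single v (1::nat)" m] by auto
  have C: "(\<Prod>w\<in>?A - {v}. fact (Poly_Mapping.lookup (Poly_Mapping.single v 1 + m) w) :: 'k) =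
     (\<Prod>w\<in>?A - {v}. fact (Poly_Mapping.lookup m w))"
    by (rule prod.cong) (auto simp: lookup_add lookup_single when_def)
  have fact_Suc': "fact (1 + k) = (1 + of_nat k) * (fact k :: 'k)" for k :: nat
    using fact_Suc[of k] by simp
  show ?thesis
    unfolding A[OF B] A[OF subset_insertI]
    by (subst (1 2) prod.remove[of _ v])
       (use C in \<open>simp_all add: lookup_add fact_Suc' algebra_simps del: One_nat_def\<close>)
qed

text \<open>The product rule: at the origin, one of the derivations has to remove the factor \<open>v\<close>, and the others
act on \<open>F\<close>.\<close>
lemma deriv_at_0_mvar_mult:
  assumes "finite S"
  shows "deriv_at_0 f S (mvar v * F) = (\<Sum>r | r \<in> S \<and> f r = v. deriv_at_0 f (S - {r}) F)"
proof (cases "\<exists>r\<in>S. f r = v")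
  case False
  have "index_monomial f S \<noteq> Poly_Mapping.single v 1 + m" for m
  proof
    assume "index_monomial f S = Poly_Mapping.single v 1 + m"
    then have "Poly_Mapping.lookup (index_monomial f S) v \<noteq> 0"
      by (simp add: lookup_add)
    then show False
      using False assms by (auto simp: lookup_index_monomial)
  qed
  then have "deriv_at_0 f S (mvar v * F) = 0"
    unfolding deriv_at_0_def mvar_def by (subst lookup_monomial_mult_eq_0) auto
  moreover have "{r. r \<in> S \<and> f r = v} = {}"
    using False by auto
  ultimately show ?thesis by (simp only: sum.empty)
next
  case True
  then obtain r0 where r0: "r0 \<in> S" "f r0 = v" by blast
  define m where "m = index_monomial f (S - {r0})"
  have split: "index_monomial f S = Poly_Mapping.single v 1 + index_monomial f (S - {r})"
    if "r \<in> S" "f r = v" for r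
    unfolding index_monomial_def using assms that by (subst sum.remove[of _ r]) auto
  have eq: "index_monomial f (S - {r}) = m" if "r \<in> S" "f r = v" for r
    using split[OF that] split[OF r0] by (simp add: m_def)
  have card: "card {r. r \<in> S \<and> f r = v} = Suc (Poly_Mapping.lookup m v)"
    using lookup_index_monomial[OF assms, of f v] split[OF r0] by (simp add: lookup_add m_def)
  have "deriv_at_0 f S (mvar v * F) =
      of_nat (Suc (Poly_Mapping.lookup m v)) * deriv_at_0 f (S - {r0}) F"
    unfolding deriv_at_0_def split[OF r0] m_def[symmetric] prod_fact_single_add
    unfolding mvar_def lookup_monomial_mult by simp
  moreover have "(\<Sum>r | r \<in> S \<and> f r = v. deriv_at_0 f (S - {r}) F) =
      (\<Sum>r | r \<in> S \<and> f r = v. deriv_at_0 f (S - {r0}) F)"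
    by (rule sum.cong) (auto simp: deriv_at_0_def eq eq[OF r0])
  ultimately show ?thesis
    by (simp only: card sum_constant)
qed

text \<open>The product rule, applied to both factors of each summand \<open>x\<^sub>p\<^sup>(\<^sup>s\<^sup>) x\<^sub>q\<^sup>(\<^sup>l\<^sup>-\<^sup>s\<^sup>)\<close>. Summing over \<open>s\<close> leaves
only the condition that the orders of the two derivations add up to \<open>l\<close>, which is symmetric in them;
this is what makes the cancellation for determinants possible.\<close>
lemma deriv_at_0_arc_product:
  fixes b :: "(nat \<times> nat, 'k::field_char_0) mpoly"
  assumes "finite S"
  shows "deriv_at_0 f S (b * fps_nth (arc_series p * arc_series q) l) =
    (\<Sum>r\<in>S. \<Sum>r'\<in>S - {r}.
       if fst (f r) = p \<and> fst (f r') = q \<and> snd (f r) + snd (f r') = l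
       then deriv_at_0 f (S - {r} - {r'}) b else 0)"
proof -
  have "b * fps_nth (arc_series p * arc_series q) l =
      (\<Sum>s=0..l. mvar (p, s) * (mvar (q, l - s) * b))"
    by (simp add: fps_mult_nth arc_series_def sum_distrib_left mult_ac)
  then have "deriv_at_0 f S (b * fps_nth (arc_series p * arc_series q) l) =
      (\<Sum>s=0..l. \<Sum>r | r \<in> S \<and> f r = (p, s). \<Sum>r' | r' \<in> S - {r} \<and> f r' = (q, l - s).
         deriv_at_0 f (S - {r} - {r'}) b)"
    using assms by (simp only: deriv_at_0_sum deriv_at_0_mvar_mult finite_Diff)
  also have "\<dots> = (\<Sum>s=0..l. \<Sum>r\<in>S. \<Sum>r'\<in>S - {r}.
         if f r = (p, s) \<and> f r' = (q, l - s) then deriv_at_0 f (S - {r} - {r'}) b else 0)"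
  proof (rule sum.cong[OF refl])
    fix s
    have "(\<Sum>r | r \<in> S \<and> f r = (p, s). \<Sum>r' | r' \<in> S - {r} \<and> f r' = (q, l - s).
         deriv_at_0 f (S - {r} - {r'}) b) =
       (\<Sum>r\<in>S. if f r = (p, s) then \<Sum>r'\<in>S - {r}.
         if f r' = (q, l - s) then deriv_at_0 f (S - {r} - {r'}) b else 0 else 0)"
      using assms by (simp only: sum.inter_filter[symmetric] finite_Diff)
    also have "\<dots> = (\<Sum>r\<in>S. \<Sum>r'\<in>S - {r}.
         if f r = (p, s) \<and> f r' = (q, l - s) then deriv_at_0 f (S - {r} - {r'}) b else 0)"
      by (intro sum.cong refl) simp
    finally show "(\<Sum>r | r \<in> S \<and> f r = (p, s). \<Sum>r' | r' \<in> S - {r} \<and> f r' = (q, l - s).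
         deriv_at_0 f (S - {r} - {r'}) b) = (\<Sum>r\<in>S. \<Sum>r'\<in>S - {r}.
         if f r = (p, s) \<and> f r' = (q, l - s) then deriv_at_0 f (S - {r} - {r'}) b else 0)" .
  qed
  also have "\<dots> = (\<Sum>r\<in>S. \<Sum>r'\<in>S - {r}. \<Sum>s=0..l.
         if f r = (p, s) \<and> f r' = (q, l - s) then deriv_at_0 f (S - {r} - {r'}) b else 0)"
    by (subst sum.swap, intro sum.cong refl, subst sum.swap) simp
  also have "\<dots> = (\<Sum>r\<in>S. \<Sum>r'\<in>S - {r}.
       if fst (f r) = p \<and> fst (f r') = q \<and> snd (f r) + snd (f r') = l
       then deriv_at_0 f (S - {r} - {r'}) b else 0)"
  proof (intro sum.cong refl)
    fix r r'
    have "(\<Sum>s=0..l. if f r = (p, s) \<and> f r' = (q, l - s) then c else 0) =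
      (\<Sum>s=0..l. if s = snd (f r) then
          (if fst (f r) = p \<and> fst (f r') = q \<and> snd (f r) + snd (f r') = l then c else 0) else 0)"
      for c :: 'k
      by (intro sum.cong refl) (auto simp: prod_eq_iff)
    then show "(\<Sum>s=0..l. if f r = (p, s) \<and> f r' = (q, l - s)
          then deriv_at_0 f (S - {r} - {r'}) b else 0) =
        (if fst (f r) = p \<and> fst (f r') = q \<and> snd (f r) + snd (f r') = l
         then deriv_at_0 f (S - {r} - {r'}) b else 0)"
      by (auto simp only: sum.delta finite_atLeastAtMost) auto
  qed
  finally show ?thesis .
qed

text \<open>The determinant of the matrix whose entry in row \<open>r\<close> and column \<open>s\<close> is the derivation with respect to
the variable \<open>(i r, a r + s)\<close>, applied at the origin.\<close>
definition alternating_functional ::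
    "(nat \<Rightarrow> nat) \<Rightarrow> (nat \<Rightarrow> nat) \<Rightarrow> nat \<Rightarrow> (nat \<times> nat, 'k::field_char_0) mpoly \<Rightarrow> 'k"
  where "alternating_functional i a d F =
    (\<Sum>\<rho> | \<rho> permutes {..<d}.
       of_int (sign \<rho>) * deriv_at_0 (\<lambda>r. (i r, a r + \<rho> r)) {..<d} F)"

text \<open>If rows \<open>r\<close> and \<open>r'\<close> act on the two factors of the coefficient, then the terms of the permutations
\<open>\<rho>\<close> and \<open>\<rho> \<circ> (r r')\<close> cancel: the orders chosen in these two rows have the same sum, all other rows
act in the same way, and the signs are opposite.\<close>
lemma alternating_functional_arc_product:
  fixes b :: "(nat \<times> nat, 'k::field_char_0) mpoly"
  shows "alternating_functional i a d (b * fps_nth (arc_series p * arc_series q) l) = 0"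
proof -
  let ?P = "{\<rho>. \<rho> permutes {..<d}}"
  define H where "H \<rho> r r' = (if i r = p \<and> i r' = q \<and> a r + \<rho> r + (a r' + \<rho> r') = l
       then deriv_at_0 (\<lambda>r. (i r, a r + \<rho> r)) ({..<d} - {r} - {r'}) b else 0)" for \<rho> r r'
  \<comment> \<open>The contributions in which rows \<open>r\<close> and \<open>r'\<close> act on the two factors cancel.\<close>
  have swap: "(\<Sum>\<rho>\<in>?P. of_int (sign \<rho>) * H \<rho> r r') = 0"
    if "r \<in> {..<d}" "r' \<in> {..<d} - {r}" for r r'
  proof -
    let ?t = "Transposition.transpose r r'"
    have t: "?t permutes {..<d}"
      using that by (intro permutes_swap_id) auto
    have H: "H (\<rho> \<circ> ?t) r r' = H \<rho> r r'" for \<rho>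
    proof -
      have "index_monomial (\<lambda>s. (i s, a s + (\<rho> \<circ> ?t) s)) ({..<d} - {r} - {r'}) =
          index_monomial (\<lambda>s. (i s, a s + \<rho> s)) ({..<d} - {r} - {r'})"
        unfolding index_monomial_def
        by (rule sum.cong) (auto simp: transpose_def)
      then show ?thesis
        by (simp add: H_def deriv_at_0_def add_ac)
    qed
    have sign: "sign (\<rho> \<circ> ?t) = - sign \<rho>" if "\<rho> permutes {..<d}" for \<rho>
      using that t \<open>r' \<in> {..<d} - {r}\<close>
      by (subst sign_compose) (auto intro: permutes_imp_permutation simp: sign_swap_id)
    have "(\<Sum>\<rho>\<in>?P. of_int (sign \<rho>) * H \<rho> r r') =
        (\<Sum>\<rho>\<in>?P. of_int (sign (\<rho> \<circ> ?t)) * H (\<rho> \<circ> ?t) r r')"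
      by (rule sum.reindex_bij_witness[of _ "\<lambda>\<rho>. \<rho> \<circ> ?t" "\<lambda>\<rho>. \<rho> \<circ> ?t"])
         (auto intro: permutes_compose[OF t] simp: comp_assoc)
    also have "\<dots> = (\<Sum>\<rho>\<in>?P. - (of_int (sign \<rho>) * H \<rho> r r'))"
      by (rule sum.cong) (auto simp: H sign)
    also have "\<dots> = - (\<Sum>\<rho>\<in>?P. of_int (sign \<rho>) * H \<rho> r r')"
      by (rule sum_negf)
    finally have "(\<Sum>\<rho>\<in>?P. of_int (sign \<rho>) * H \<rho> r r') =
        - (\<Sum>\<rho>\<in>?P. of_int (sign \<rho>) * H \<rho> r r')" .
    then show ?thesis by simp
  qed
  have "alternating_functional i a d (b * fps_nth (arc_series p * arc_series q) l) =
      (\<Sum>\<rho>\<in>?P. \<Sum>r<d. \<Sum>r'\<in>{..<d} - {r}. of_int (sign \<rho>) * H \<rho> r r')"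
    unfolding alternating_functional_def H_def
    by (simp only: deriv_at_0_arc_product[OF finite_lessThan] sum_distrib_left fst_conv snd_conv)
  also have "\<dots> = (\<Sum>r<d. \<Sum>\<rho>\<in>?P. \<Sum>r'\<in>{..<d} - {r}. of_int (sign \<rho>) * H \<rho> r r')"
    by (rule sum.swap)
  also have "\<dots> = (\<Sum>r<d. \<Sum>r'\<in>{..<d} - {r}. \<Sum>\<rho>\<in>?P. of_int (sign \<rho>) * H \<rho> r r')"
    by (rule sum.cong[OF refl]) (rule sum.swap)
  also have "\<dots> = 0"
    by (intro sum.neutral ballI swap)
  finally show ?thesis .
qed

text \<open>The polynomials all of whose multiples are killed by the functional form an ideal. It contains the
generators, since the functional vanishes on all multiples of the coefficients of products of two arcs.\<close>
lemma alternating_functional_fat_point_arc_ideal: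
  fixes F :: "(nat \<times> nat, 'k::field_char_0) mpoly"
  assumes "F \<in> fat_point_arc_ideal n"
  shows "alternating_functional i a d F = 0"
proof -
  interpret cring "poly_ring (arc_vars n) :: (nat \<times> nat, 'k) mpoly ring"
    by (rule poly_ring_cring)
  let ?I = "{F :: (nat \<times> nat, 'k) mpoly. \<forall>b. alternating_functional i a d (b * F) = 0}"
  have add: "alternating_functional i a d (p + q) =
      alternating_functional i a d p + alternating_functional i a d q"
    for p q :: "(nat \<times> nat, 'k) mpoly"
    by (simp add: alternating_functional_def deriv_at_0_add sum.distrib algebra_simps)
  have zero: "alternating_functional i a d (0 :: (nat \<times> nat, 'k) mpoly) = 0"
    by (simp add: alternating_functional_def)
  have closed: "0 \<in> ?I" "\<And>p q. p \<in> ?I \<Longrightarrow> q \<in> ?I \<Longrightarrow> p + q \<in> ?I" "\<And>a p. p \<in> ?I \<Longrightarrow> a * p \<in> ?I"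
    by (simp_all add: zero add distrib_left mult.assoc[symmetric])
  have "ideal (?I \<inter> {p. mvars p \<subseteq> arc_vars n}) (poly_ring (arc_vars n))"
  proof (rule ideal_poly_ringI)
    fix p q :: "(nat \<times> nat, 'k) mpoly"
    assume "p \<in> ?I \<inter> {p. mvars p \<subseteq> arc_vars n}" "q \<in> ?I \<inter> {p. mvars p \<subseteq> arc_vars n}"
    then show "p + q \<in> ?I \<inter> {p. mvars p \<subseteq> arc_vars n}"
      using closed(2)[of p q] mvars_add[of p q] by blast
  next
    fix a p :: "(nat \<times> nat, 'k) mpoly"
    assume "mvars a \<subseteq> arc_vars n" "p \<in> ?I \<inter> {p. mvars p \<subseteq> arc_vars n}"
    then show "a * p \<in> ?I \<inter> {p. mvars p \<subseteq> arc_vars n}"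
      using closed(3)[of p a] mvars_mult[of a p] by blast
  qed (use closed(1) in auto)
  moreover have gens: "fps_nth (arc_subst f) l \<in> ?I" if "f \<in> fat_point_ideal n" for f l
    using arc_subst_coeffs_in[OF closed _ that]
    by (auto simp: coeffs_in_def alternating_functional_arc_product)
  ultimately have "fat_point_arc_ideal n \<subseteq> ?I \<inter> {p. mvars p \<subseteq> arc_vars n}"
    unfolding arc_ideal_def
    using fat_point_arc_ideal_generators_subset[of n]
    by (intro genideal_minimal subsetI) (fastforce dest: gens)+
  then have "\<forall>b. alternating_functional i a d (b * F) = 0"
    using assms by blast
  from spec[OF this, of 1] show ?thesis by simp
qed

section \<open>Normal words\<close>

text \<open>The variables of a normal monomial are listed as letters \<open>(i, b)\<close> by increasing \<open>i\<close> and, for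
equal \<open>i\<close>, by weakly decreasing \<open>b\<close>; the letter in place \<open>r\<close> satisfies \<open>r \<le> b \<le> h\<close>.
The recursion produces the possible continuations of such a word. Here \<open>p\<close> indices are still
available, namely \<open>n - p + 1, \<dots>, n\<close>; the next letter of index \<open>n - p + 1\<close> has \<open>b \<le> h - g\<close>, and
it may have \<open>e\<close> different values of \<open>b\<close>, so that the next place is \<open>h + 1 - g - e\<close>. Each step either
excludes the largest value of \<open>b\<close> or uses it and moves on to the next place; both leave one value
less. When no value is left, the next index takes over, with \<open>g\<close> possible values up to \<open>h\<close>.\<close>
fun normal_words :: "nat \<Rightarrow> nat \<Rightarrow> nat \<Rightarrow> nat \<Rightarrow> nat \<Rightarrow> (nat \<times> nat) list set"
  where
    "normal_words n h 0 g e = {[]}"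
  | "normal_words n h (Suc p) g 0 = normal_words n h p 0 g"
  | "normal_words n h (Suc p) g (Suc e) = normal_words n h (Suc p) (Suc g) e \<union>
       Cons (n - p, h - g) ` normal_words n h (Suc p) g e"

text \<open>On letters with \<open>b \<le> h\<close> this is the order of letters in normal words, reversed. It is additive in the second
component: raising the order of a variable by \<open>s\<close> raises its position by \<open>s\<close>.\<close>
definition position :: "nat \<Rightarrow> nat \<Rightarrow> nat \<times> nat \<Rightarrow> nat"
  where "position n h v = Suc h * (n - fst v) + snd v"

text \<open>For \<open>p > 0\<close> and \<open>g \<le> h\<close> the bound says that the word starts at or after the letter \<open>(n - p + 1, h - g)\<close>.
The additive form, with \<open>g\<close> on the left, remains correct when the next index takes over.\<close>
lemma position_less:
  "\<lbrakk>w \<in> normal_words n h p g e; p \<le> n; g + e \<le> Suc h; v \<in> set w\<rbrakk>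
     \<Longrightarrow> position n h v + g < Suc h * p"
proof (induction n h p g e arbitrary: w v rule: normal_words.induct)
  case (2 n h p g)
  then have "position n h v < Suc h * p" and "g \<le> Suc h"
    by simp_all
  then show ?case
    unfolding mult_Suc_right by linarith
next
  case (3 n h p g e)
  consider "w \<in> normal_words n h (Suc p) (Suc g) e"
    | w' where "w = (n - p, h - g) # w'" "w' \<in> normal_words n h (Suc p) g e"
    using "3.prems"(1) by auto
  then show ?case
  proof cases
    case 1
    then have "position n h v + Suc g < Suc h * Suc p"
      using 3 by (intro "3.IH"(1)) auto
    then show ?thesis by simp
  next
    case 2
    show ?thesis
    proof (cases "v = (n - p, h - g)")
      case True
      then show ?thesis
        using "3.prems" by (simp add: position_def)
    next
      case False
      then show ?thesis
        using 2 3 by (intro "3.IH"(2)) auto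
    qed
  qed
qed simp

lemma normal_words_sorted:
  "\<lbrakk>w \<in> normal_words n h p g e; p \<le> n; g + e \<le> Suc h\<rbrakk>
     \<Longrightarrow> sorted_wrt (\<ge>) (map (position n h) w)"
proof (induction n h p g e arbitrary: w rule: normal_words.induct)
  case (3 n h p g e)
  have "position n h v \<le> position n h (n - p, h - g)"
    if "w' \<in> normal_words n h (Suc p) g e" "v \<in> set w'" for w' v
    using position_less[OF that(1) _ _ that(2)] "3.prems" by (simp add: position_def)
  then show ?case
    using 3 by auto
qed auto

lemma normal_words_nth:
  "\<lbrakk>w \<in> normal_words n h p g e; p \<le> n; g + e \<le> Suc h; r < length w\<rbrakk>
     \<Longrightarrow> w ! r \<in> {1..n} \<times> {..h} \<and> Suc h - (g + e) + r \<le> snd (w ! r)"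
proof (induction n h p g e arbitrary: w r rule: normal_words.induct)
  case (2 n h p g)
  then show ?case by simp
next
  case (3 n h p g e)
  consider "w \<in> normal_words n h (Suc p) (Suc g) e"
    | w' where "w = (n - p, h - g) # w'" "w' \<in> normal_words n h (Suc p) g e"
    using "3.prems"(1) by auto
  then show ?case
  proof cases
    case 1
    then show ?thesis
      using "3.IH"(1)[OF 1, of r] "3.prems" by simp
  next
    case 2
    then show ?thesis
      using "3.IH"(2)[OF 2(2), of "r - 1"] "3.prems" by (cases r) auto
  qed
qed simp

lemma finite_normal_words: "finite (normal_words n h p g e)"
  by (induction n h p g e rule: normal_words.induct) auto

text \<open>With \<open>T(g, e) = p ^ g (p + 1) ^ e\<close> the recursion becomes \<open>T(g, e + 1) = T(g + 1, e) + T(g, e)\<close>, and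
at \<open>e = 0\<close> the value \<open>p ^ g\<close> is that of \<open>(p - 1) ^ 0 p ^ g\<close>, the count for one index less. The two
alternatives of the recursion are disjoint because of \<open>position_less\<close>.\<close>
lemma card_normal_words:
  "\<lbrakk>p \<le> n; g + e \<le> Suc h; 0 < p \<or> g = 0\<rbrakk>
     \<Longrightarrow> card (normal_words n h p g e) = p ^ g * (p + 1) ^ e"
proof (induction n h p g e rule: normal_words.induct)
  case (3 n h p g e)
  have "normal_words n h (Suc p) (Suc g) e \<inter>
      Cons (n - p, h - g) ` normal_words n h (Suc p) g e = {}"
  proof -
    have "(n - p, h - g) # w \<notin> normal_words n h (Suc p) (Suc g) e" for w
      using position_less[of "(n - p, h - g) # w" n h "Suc p" "Suc g" e "(n - p, h - g)"] "3.prems"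
      by (auto simp: position_def)
    then show ?thesis by auto
  qed
  then have "card (normal_words n h (Suc p) g (Suc e)) =
      card (normal_words n h (Suc p) (Suc g) e) + card (normal_words n h (Suc p) g e)"
    by (simp add: card_Un_disjoint card_image finite_normal_words)
  also have "\<dots> = Suc p ^ Suc g * (Suc p + 1) ^ e + Suc p ^ g * (Suc p + 1) ^ e"
    using "3.IH" "3.prems" by simp
  finally show ?case by (simp add: algebra_simps)
qed auto

abbreviation word_monomial :: "(nat \<times> nat) list \<Rightarrow> nat \<times> nat \<Rightarrow>\<^sub>0 nat"
  where "word_monomial w \<equiv> index_monomial ((!) w) {..<length w}"

lemma mset_eq_if_word_monomial_eq:
  assumes "word_monomial w = word_monomial w'"
  shows "mset w = mset w'"
proof (rule multiset_eqI)
  have "count (mset xs) v = Poly_Mapping.lookup (word_monomial xs) v" for xs v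
    unfolding count_mset count_list_eq_length_filter length_filter_conv_card
      lookup_index_monomial[OF finite_lessThan]
    by (rule arg_cong[where f = card]) auto
  then show "count (mset w) v = count (mset w') v" for v
    using assms by simp
qed

lemma inj_on_position: "inj_on (position n h) ({1..n} \<times> {..h})"
proof (rule inj_onI)
  fix v w
  assume v: "v \<in> {1..n} \<times> {..h}" and w: "w \<in> {1..n} \<times> {..h}"
    and eq: "position n h v = position n h w"
  have "snd v = position n h v mod Suc h" "snd w = position n h w mod Suc h"
    using v w by (auto simp: position_def simp del: mult_Suc)
  moreover have "n - fst v = position n h v div Suc h" "n - fst w = position n h w div Suc h"
    using v w by (auto simp: position_def simp del: mult_Suc)
  ultimately show "v = w"
    using v w eq by (auto simp: prod_eq_iff)
qed

text \<open>A monomial determines the multiset of its letters, and a normal word is the sorted list of them.\<close>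
lemma inj_on_word_monomial: "inj_on word_monomial (normal_words n h n 0 (Suc h))"
proof (rule inj_onI)
  fix w w'
  assume w: "w \<in> normal_words n h n 0 (Suc h)" and w': "w' \<in> normal_words n h n 0 (Suc h)"
    and eq: "word_monomial w = word_monomial w'"
  have sub: "set xs \<subseteq> {1..n} \<times> {..h}" if "xs \<in> normal_words n h n 0 (Suc h)" for xs
    using normal_words_nth[OF that order_refl] by (metis add_0 in_set_conv_nth order_refl subsetI)
  have sorted: "sorted (rev (map (position n h) xs))"
    if "xs \<in> normal_words n h n 0 (Suc h)" for xs
    using normal_words_sorted[OF that] by (simp add: sorted_wrt_rev)
  have "mset (rev (map (position n h) w)) = mset (rev (map (position n h) w'))"
    using mset_eq_if_word_monomial_eq[OF eq] by simp
  then have "rev (map (position n h) w) = rev (map (position n h) w')"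
    using properties_for_sort[OF _ sorted[OF w]] properties_for_sort[OF _ sorted[OF w']]
    by metis
  then have "map (position n h) w = map (position n h) w'"
    by simp
  then show "w = w'"
    using map_inj_on[OF _ inj_on_subset[OF inj_on_position, of "set w \<union> set w'" n h]] sub[OF w] sub[OF w']
    by blast
qed

section \<open>Linear independence of the normal words\<close>

text \<open>The rearrangement inequality, in the strict form. If \<open>\<rho>\<close> does not fix the last place,
exchanging its value there with the largest value strictly decreases the sum and leaves a permutation
that fixes the last place.\<close>
lemma sum_permutation_greater:
  fixes \<kappa> :: "nat \<Rightarrow> nat"
  assumes "\<And>r s. r < s \<Longrightarrow> s < d \<Longrightarrow> \<kappa> s < \<kappa> r" and "\<rho> permutes {..<d}" and "\<rho> \<noteq> id"
  shows "(\<Sum>r<d. \<kappa> r * r) < (\<Sum>r<d. \<kappa> r * \<rho> r)"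
  using assms
proof (induction d arbitrary: \<rho>)
  case 0
  then show ?case by simp
next
  case (Suc d)
  have fixes_last: "\<sigma> permutes {..<d}" if "\<sigma> permutes {..<Suc d}" "\<sigma> d = d" for \<sigma>
    using that by (intro permutes_superset[OF that(1)]) (auto simp: less_Suc_eq)
  show ?case
  proof (cases "\<rho> d = d")
    case True
    then show ?thesis
      using Suc.IH[OF Suc.prems(1) fixes_last[OF Suc.prems(2)] Suc.prems(3)] by simp
  next
    case False
    define e where "e = \<rho> d"
    have "e \<in> {..<Suc d}"
      unfolding e_def using permutes_in_image[OF Suc.prems(2)] by blast
    then have e: "e < d"
      using False by (simp add: e_def)
    obtain r0 where r0: "\<rho> r0 = d" "r0 \<in> {..<Suc d}"
      using permutes_image[OF Suc.prems(2)] by (metis imageE lessThan_iff lessI)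
    then have "r0 < d"
      using False by (cases "r0 = d") auto
    \<comment> \<open>Only the values at \<open>r0\<close> and at the last place change, from \<open>d, e\<close> to \<open>e, d\<close>.\<close>
    define \<sigma> where "\<sigma> = Transposition.transpose e d \<circ> \<rho>"
    have perm: "\<sigma> permutes {..<Suc d}"
      unfolding \<sigma>_def using e Suc.prems(2)
      by (intro permutes_compose permutes_swap_id) auto
    have val: "\<sigma> d = d" "\<sigma> r0 = e"
      using r0 by (simp_all add: \<sigma>_def e_def)
    have other: "\<sigma> r = \<rho> r" if "r \<noteq> d" "r \<noteq> r0" for r
    proof -
      have "\<rho> r \<noteq> e" "\<rho> r \<noteq> d"
        using that r0 permutes_inj[OF Suc.prems(2)] unfolding e_def by (auto dest: injD)
      then show ?thesis by (simp add: \<sigma>_def)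
    qed
    have "(\<Sum>r<d. \<kappa> r * r) \<le> (\<Sum>r<d. \<kappa> r * \<sigma> r)"
    proof (cases "\<sigma> = id")
      case True
      then show ?thesis by simp
    next
      case False
      then show ?thesis
        using Suc.IH[OF Suc.prems(1) fixes_last[OF perm val(1)] False] by simp
    qed
    moreover have "(\<Sum>r<d. \<kappa> r * \<rho> r) = \<kappa> r0 * d + (\<Sum>r\<in>{..<d} - {r0}. \<kappa> r * \<rho> r)"
      using \<open>r0 < d\<close> r0 by (subst sum.remove[of _ r0]) auto
    moreover have "(\<Sum>r<d. \<kappa> r * \<sigma> r) = \<kappa> r0 * e + (\<Sum>r\<in>{..<d} - {r0}. \<kappa> r * \<rho> r)"
      using \<open>r0 < d\<close> val other by (subst sum.remove[of _ r0]) auto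
    moreover have "\<kappa> r0 * e + \<kappa> d * d < \<kappa> r0 * d + \<kappa> d * e"
    proof -
      have "\<kappa> d < \<kappa> r0"
        using Suc.prems(1)[OF \<open>r0 < d\<close>] by simp
      then obtain x y where "\<kappa> r0 = \<kappa> d + Suc x" "d = e + Suc y"
        using e unfolding less_iff_Suc_add by auto
      then show ?thesis by (simp only:) (simp add: algebra_simps)
    qed
    ultimately show ?thesis
      by (simp add: e_def[symmetric])
  qed
qed

text \<open>A strictly convex function of the positions, hence smallest on the most balanced monomials.\<close>
definition weight :: "nat \<Rightarrow> nat \<Rightarrow> (nat \<times> nat \<Rightarrow>\<^sub>0 nat) \<Rightarrow> nat"
  where "weight n h m =
    (\<Sum>v\<in>Poly_Mapping.keys m. Poly_Mapping.lookup m v * (position n h v)\<^sup>2)"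

lemma weight_index_monomial:
  "weight n h (index_monomial f S) = (\<Sum>r\<in>S. (position n h (f r))\<^sup>2)"
proof -
  have "weight n h (a + b) = weight n h a + weight n h b" for a b
    unfolding weight_def
    by (rule setsum_keys_plus_distrib[where f = "\<lambda>v k. k * (position n h v)\<^sup>2"])
       (simp_all add: algebra_simps)
  moreover have "weight n h 0 = 0" "weight n h (Poly_Mapping.single v 1) = (position n h v)\<^sup>2" for v
    by (simp_all add: weight_def)
  ultimately show ?thesis
    unfolding index_monomial_def
    by (induction S rule: infinite_finite_induct) simp_all
qed

text \<open>Let \<open>w\<^sub>0\<close> have the largest weight among the normal words with a nonzero coefficient, and take the
determinantal functional with the rows \<open>(i\<^sub>r, b\<^sub>r - r)\<close>, where \<open>(i\<^sub>r, b\<^sub>r)\<close> are the letters of \<open>w\<^sub>0\<close>. Its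
diagonal term picks out the monomial of \<open>w\<^sub>0\<close>. The numbers \<open>\<kappa> r\<close>, the positions of the rows, are
strictly decreasing, so by the rearrangement inequality the monomials of all other terms have a larger
weight and do not occur. Since the functional vanishes on the arc ideal, the coefficient of \<open>w\<^sub>0\<close> is 0.\<close>
lemma normal_words_independent:
  fixes c :: "(nat \<times> nat) list \<Rightarrow> 'k::field_char_0"
  assumes "(\<Sum>w\<in>normal_words n h n 0 (Suc h). Poly_Mapping.single (word_monomial w) (c w))
      \<in> fat_point_arc_ideal n"
    and "w \<in> normal_words n h n 0 (Suc h)"
  shows "c w = 0"
proof (rule ccontr)
  let ?N = "normal_words n h n 0 (Suc h)"
  let ?wt = "\<lambda>w. weight n h (word_monomial w)"
  define G where "G = (\<Sum>w\<in>?N. Poly_Mapping.single (word_monomial w) (c w))"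
  have lookup_G: "Poly_Mapping.lookup G m = (\<Sum>w\<in>?N. if word_monomial w = m then c w else 0)" for m
    by (simp add: G_def lookup_sum lookup_single when_def)
  assume "c w \<noteq> 0"
  define A where "A = {w \<in> ?N. c w \<noteq> 0}"
  have "finite A" "A \<noteq> {}"
    using \<open>c w \<noteq> 0\<close> assms(2) finite_normal_words by (auto simp: A_def)
  then obtain w0 where "w0 \<in> A" and "Max (?wt ` A) = ?wt w0"
    by (rule obtains_MAX[where f = ?wt])
  then have w0: "w0 \<in> ?N" "c w0 \<noteq> 0"
    and max: "\<And>w. w \<in> ?N \<Longrightarrow> c w \<noteq> 0 \<Longrightarrow> ?wt w \<le> ?wt w0"
    using \<open>finite A\<close> by (auto simp: A_def simp flip: \<open>Max (?wt ` A) = ?wt w0\<close>)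
  define d where "d = length w0"
  define f where "f \<rho> r = (fst (w0 ! r), snd (w0 ! r) - r + \<rho> r)" for \<rho> r
  define \<kappa> where "\<kappa> r = position n h (w0 ! r) - r" for r
  have snd_ge: "r \<le> snd (w0 ! r)" if "r < d" for r
    using normal_words_nth[OF w0(1), of r] that by (simp add: d_def)
  have position_ge: "r \<le> position n h (w0 ! r)" if "r < d" for r
    using snd_ge[OF that] by (simp add: position_def)
  have position_f: "position n h (f \<rho> r) = \<kappa> r + \<rho> r" if "r < d" for \<rho> r
    using snd_ge[OF that] by (simp add: position_def f_def \<kappa>_def)
  have decreasing: "\<kappa> s < \<kappa> r" if "r < s" "s < d" for r s
  proof -
    have "position n h (w0 ! s) \<le> position n h (w0 ! r)"
      using normal_words_sorted[OF w0(1)] that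
      by (simp add: sorted_wrt_iff_nth_less d_def)
    then show ?thesis
      using that position_ge[of s] by (simp add: \<kappa>_def)
  qed
  have f_id: "index_monomial (f id) {..<d} = word_monomial w0"
    unfolding index_monomial_def
    by (rule sum.cong) (auto simp: f_def snd_ge d_def)
  \<comment> \<open>In the weights \<open>\<Sum>\<^sub>r (\<kappa> r + \<rho> r)\<^sup>2\<close> only the mixed term depends on the permutation.\<close>
  have "deriv_at_0 (f \<rho>) {..<d} G = 0" if \<rho>: "\<rho> permutes {..<d}" "\<rho> \<noteq> id" for \<rho>
  proof -
    have sum: "weight n h (index_monomial (f \<sigma>) {..<d}) =
        (\<Sum>r<d. (\<kappa> r)\<^sup>2) + 2 * (\<Sum>r<d. \<kappa> r * \<sigma> r) + (\<Sum>r<d. r\<^sup>2)"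
      if "\<sigma> permutes {..<d}" for \<sigma>
    proof -
      have "(\<Sum>r<d. (\<sigma> r)\<^sup>2) = (\<Sum>r<d. r\<^sup>2)"
        using sum.permute[OF that, of "\<lambda>r. r\<^sup>2"] by (simp add: comp_def)
      then show ?thesis
        by (simp add: weight_index_monomial position_f power2_sum sum.distrib
            sum_distrib_left algebra_simps)
    qed
    have "?wt w0 < weight n h (index_monomial (f \<rho>) {..<d})"
      unfolding f_id[symmetric] sum[OF \<rho>(1)] sum[OF permutes_id]
      using sum_permutation_greater[of d \<kappa>, OF decreasing \<rho>] by simp
    then have "word_monomial w \<noteq> index_monomial (f \<rho>) {..<d} \<or> c w = 0" if "w \<in> ?N" for w
      using max[OF that] by (metis not_less)
    then have "Poly_Mapping.lookup G (index_monomial (f \<rho>) {..<d}) = 0"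
      unfolding lookup_G by (intro sum.neutral) auto
    then show ?thesis
      by (simp add: deriv_at_0_def)
  qed
  then have "alternating_functional (\<lambda>r. fst (w0 ! r)) (\<lambda>r. snd (w0 ! r) - r) d G =
      (\<Sum>\<rho>\<in>{id}. of_int (sign \<rho>) * deriv_at_0 (f \<rho>) {..<d} G)"
    unfolding alternating_functional_def f_def[abs_def]
    by (intro sum.mono_neutral_right) (auto simp: permutes_id finite_permutations)
  also have "\<dots> = deriv_at_0 (f id) {..<d} G"
    by (simp add: sign_id)
  finally have "deriv_at_0 (f id) {..<d} G = 0"
    using alternating_functional_fat_point_arc_ideal[OF assms(1)] by (simp add: G_def)
  then have "Poly_Mapping.lookup G (word_monomial w0) = 0"
    by (simp add: deriv_at_0_def f_id)
  moreover have "Poly_Mapping.lookup G (word_monomial w0) = (\<Sum>w\<in>?N. if w = w0 then c w else 0)"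
    unfolding lookup_G using inj_on_word_monomial w0(1)
    by (intro sum.cong) (auto dest: inj_onD)
  ultimately show False
    using w0 finite_normal_words by simp
qed

section \<open>Linear dependence and interpolation\<close>

text \<open>The numbers \<open>c j p\<close> are the coefficients of the Lagrange polynomials for the nodes \<open>0, \<dots>, N - 1\<close>, which
are distinct in characteristic zero. The identity compares the coefficients of a monomial with those of
its interpolation polynomial.\<close>
lemma inverse_vandermonde:
  "\<exists>c :: nat \<Rightarrow> nat \<Rightarrow> 'k::field_char_0. \<forall>j. \<forall>m<N.
     (\<Sum>p<N. c j p * of_nat p ^ m) = (if j = m then 1 else 0)"
proof (cases N)
  case (Suc N')
  define L :: "nat \<Rightarrow> 'k poly"
    where "L p = (\<Prod>q\<in>{..<N} - {p}. smult (inverse (of_nat p - of_nat q)) [:- of_nat q, 1:])" for p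
  have L_eval: "poly (L p) (of_nat r) = (if r = p then 1 else 0)" if "p < N" "r < N" for p r
  proof (cases "r = p")
    case True
    then show ?thesis
      unfolding L_def poly_prod
      by (auto intro!: prod.neutral simp: divide_simps simp flip: divide_inverse_commute)
  next
    case False
    then have "r \<in> {..<N} - {p}"
      using that by simp
    then show ?thesis
      using False unfolding L_def poly_prod by (auto intro!: prod_zero)
  qed
  have L_degree: "degree (L p) \<le> N'" if "p < N" for p
  proof -
    have "degree (L p) \<le> (\<Sum>q\<in>{..<N} - {p}. 1)"
      unfolding L_def
      by (rule order.trans[OF degree_prod_sum_le], simp, rule sum_mono)
         (simp add: order.trans[OF degree_smult_le])
    then show ?thesis
      using that Suc by simp
  qed
  have interpolation: "(\<Sum>p<N. smult (of_nat p ^ m) (L p)) = monom 1 m" if "m < N" for m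
  proof (rule poly_eqI_degree[where A = "of_nat ` {..<N}"])
    fix x :: 'k assume "x \<in> of_nat ` {..<N}"
    then obtain r where r: "x = of_nat r" "r < N" by auto
    have "poly (\<Sum>p<N. smult (of_nat p ^ m) (L p)) x =
        (\<Sum>p<N. if r = p then of_nat p ^ m else 0)"
      unfolding poly_sum r(1) by (intro sum.cong) (auto simp: L_eval r(2))
    then show "poly (\<Sum>p<N. smult (of_nat p ^ m) (L p)) x = poly (monom 1 m) x"
      using r by (simp add: poly_monom)
  next
    have card: "card (of_nat ` {..<N} :: 'k set) = N"
      by (simp add: card_image inj_on_def)
    have "degree (\<Sum>p<N. smult (of_nat p ^ m) (L p)) \<le> N'"
      by (intro degree_sum_le order.trans[OF degree_smult_le L_degree]) auto
    then show "degree (\<Sum>p<N. smult (of_nat p ^ m) (L p)) < card (of_nat ` {..<N} :: 'k set)"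
      unfolding card using Suc by simp
    show "degree (monom 1 m :: 'k poly) < card (of_nat ` {..<N} :: 'k set)"
      unfolding card using that by (simp add: degree_monom_eq)
  qed
  have "(\<Sum>p<N. coeff (L p) j * of_nat p ^ m) = (if j = m then 1 else 0)" if "m < N" for j m
    using arg_cong[OF interpolation[OF that], of "\<lambda>q. coeff q j"]
    by (simp add: coeff_sum mult.commute eq_commute)
  then show ?thesis
    by (intro exI[of _ "\<lambda>j p. coeff (L p) j"]) blast
qed simp

text \<open>Gaussian elimination without division: a column is cleared by cross-multiplication with a nonzero
entry of it.\<close>
lemma linearly_dependent_if_too_many:
  fixes a :: "'r \<Rightarrow> 's \<Rightarrow> 'd::idom"
  assumes "finite S" "finite T" "card S < card T"
  shows "\<exists>c. (\<exists>r\<in>T. c r \<noteq> 0) \<and> (\<forall>s\<in>S. (\<Sum>r\<in>T. c r * a r s) = 0)"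
  using assms
proof (induction S arbitrary: T a rule: finite_induct)
  case empty
  then have "T \<noteq> {}" by auto
  then show ?case
    by (intro exI[of _ "\<lambda>_. 1"]) auto
next
  case (insert s S)
  show ?case
  proof (cases "\<forall>r\<in>T. a r s = 0")
    case True
    have "card S < card T"
      using insert.prems insert.hyps by simp
    then obtain c where "\<exists>r\<in>T. c r \<noteq> 0" "\<forall>s\<in>S. (\<Sum>r\<in>T. c r * a r s) = 0"
      using insert.IH[OF insert.prems(1), of a] by auto
    then show ?thesis
      using True by (intro exI[of _ c]) auto
  next
    case False
    then obtain r0 where r0: "r0 \<in> T" "a r0 s \<noteq> 0" by blast
    define T' where "T' = T - {r0}"
    have "finite T'" "card S < card T'"
      using insert.prems insert.hyps r0 by (auto simp: T'_def)
    then obtain c where c: "\<exists>r\<in>T'. c r \<noteq> 0"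
        "\<forall>s'\<in>S. (\<Sum>r\<in>T'. c r * (a r0 s * a r s' - a r s * a r0 s')) = 0"
      using insert.IH[of T' "\<lambda>r s'. a r0 s * a r s' - a r s * a r0 s'"] by auto
    \<comment> \<open>The coefficient of row \<open>r0\<close> is chosen so that the column \<open>s\<close> is killed.\<close>
    define c' where "c' r = (if r = r0 then - (\<Sum>r\<in>T'. c r * a r s) else c r * a r0 s)" for r
    have "\<exists>r\<in>T. c' r \<noteq> 0"
      using c(1) r0 by (auto simp: c'_def T'_def)
    moreover have "(\<Sum>r\<in>T. c' r * a r s') = 0" if "s' \<in> insert s S" for s'
    proof -
      have "(\<Sum>r\<in>T'. c' r * a r s') = (\<Sum>r\<in>T'. c r * a r0 s * a r s')"
        by (rule sum.cong) (auto simp: c'_def T'_def)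
      then have "(\<Sum>r\<in>T. c' r * a r s') =
          - (\<Sum>r\<in>T'. c r * a r s) * a r0 s' + (\<Sum>r\<in>T'. c r * a r0 s * a r s')"
        using insert.prems(1) r0 by (simp add: sum.remove[of T r0] T'_def[symmetric] c'_def)
      also have "\<dots> = (\<Sum>r\<in>T'. c r * (a r0 s * a r s' - a r s * a r0 s'))"
        by (simp add: sum_distrib_right sum_subtractf right_diff_distrib mult.assoc)
      finally show ?thesis
        using c(2) that by (auto simp: mult.commute)
    qed
    ultimately show ?thesis by blast
  qed
qed

text \<open>A relation over the power series may be divided by the largest power of the variable that divides all
of its coefficients.\<close>
lemma linearly_dependent_power_series:
  fixes a :: "'r \<Rightarrow> 's \<Rightarrow> 'k::field fps"
  assumes "finite S" "finite T" "card S < card T"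
  shows "\<exists>c. (\<exists>r\<in>T. fps_nth (c r) 0 \<noteq> 0) \<and> (\<forall>s\<in>S. (\<Sum>r\<in>T. c r * a r s) = 0)"
proof -
  obtain c where c: "\<exists>r\<in>T. c r \<noteq> 0" "\<forall>s\<in>S. (\<Sum>r\<in>T. c r * a r s) = 0"
    using linearly_dependent_if_too_many[OF assms] by blast
  define A where "A = {r \<in> T. c r \<noteq> 0}"
  have "finite A" "A \<noteq> {}"
    using c(1) assms(2) by (auto simp: A_def)
  then obtain r0 where r0: "r0 \<in> A" "Min ((\<lambda>r. subdegree (c r)) ` A) = subdegree (c r0)"
    by (rule obtains_MIN[where f = "\<lambda>r. subdegree (c r)"])
  define k where "k = subdegree (c r0)"
  have "k \<le> subdegree (c r)" if "r \<in> A" for r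
    using that \<open>finite A\<close> by (simp add: k_def flip: r0(2))
  then have shift: "c r = fps_X ^ k * fps_shift k (c r)" if "r \<in> T" for r
    using that
    by (cases "c r = 0") (auto simp: A_def fps_shift_times_fps_X_power mult.commute[of "fps_X ^ k"])
  have "(\<Sum>r\<in>T. fps_shift k (c r) * a r s) = 0" if "s \<in> S" for s
  proof -
    have "fps_X ^ k * (\<Sum>r\<in>T. fps_shift k (c r) * a r s) = (\<Sum>r\<in>T. c r * a r s)"
      unfolding sum_distrib_left mult.assoc[symmetric]
      by (rule sum.cong) (simp_all flip: shift)
    then show ?thesis
      using c(2) that by simp
  qed
  moreover have "fps_nth (fps_shift k (c r0)) 0 \<noteq> 0"
    using r0(1) by (simp add: A_def k_def)
  ultimately show ?thesis
    using r0(1) by (intro exI[of _ "\<lambda>r. fps_shift k (c r)"]) (auto simp: A_def)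
qed

section \<open>Arcs evaluated at infinitely near points\<close>

text \<open>The base change of power series from \<open>k\<close> to the polynomial ring. The variable of these power series
plays the role of the deformation parameter \<open>\<epsilon>\<close>.\<close>
definition scalar_series :: "'k::comm_ring_1 fps \<Rightarrow> ('v, 'k) mpoly fps"
  where "scalar_series f = Abs_fps (\<lambda>l. mconst (fps_nth f l))"

lemma scalar_series_nth [simp]: "fps_nth (scalar_series f) l = mconst (fps_nth f l)"
  by (simp add: scalar_series_def)

lemma scalar_series_add: "scalar_series (f + g) = scalar_series f + scalar_series g"
  by (simp add: fps_eq_iff mconst_add)

lemma scalar_series_mult: "scalar_series (f * g) = scalar_series f * scalar_series g"
  by (simp add: fps_eq_iff fps_mult_nth mconst_sum mconst_mult)

lemma scalar_series_0 [simp]: "scalar_series 0 = 0"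
  by (simp add: fps_eq_iff)

lemma scalar_series_1 [simp]: "scalar_series 1 = 1"
  by (simp add: fps_eq_iff)

lemma scalar_series_sum: "scalar_series (sum f A) = (\<Sum>x\<in>A. scalar_series (f x))"
  by (induction A rule: infinite_finite_induct) (simp_all add: scalar_series_add)

lemma scalar_series_X_power: "scalar_series (fps_X ^ k) = fps_X ^ k"
  by (simp add: fps_eq_iff)

lemma scalar_series_const: "scalar_series (fps_const c) = fps_const (mconst c)"
  by (simp add: fps_eq_iff)

lemma scalar_series_coeffs_in: "scalar_series f \<in> coeffs_in {p. mvars p \<subseteq> V}"
  by (simp add: coeffs_in_def)

lemma arc_ideal_series_closed:
  fixes F G :: "(nat \<times> nat, 'k::comm_ring_1) mpoly fps"
  shows "F \<in> coeffs_in (fat_point_arc_ideal n) \<Longrightarrow> G \<in> coeffs_in (fat_point_arc_ideal n) \<Longrightarrow>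
      F + G \<in> coeffs_in (fat_point_arc_ideal n)"
    and "G \<in> coeffs_in {p. mvars p \<subseteq> arc_vars n} \<Longrightarrow> F \<in> coeffs_in (fat_point_arc_ideal n) \<Longrightarrow>
      G * F \<in> coeffs_in (fat_point_arc_ideal n)"
  by (auto simp: coeffs_in_def intro: fat_point_arc_ideal_closed(2))
     (auto simp: fps_mult_nth intro!: fat_point_arc_ideal_sum fat_point_arc_ideal_closed(3))

text \<open>The arc \<open>x\<^sub>i(p \<epsilon>)\<close>.\<close>
definition evaluated_arc :: "nat \<Rightarrow> nat \<Rightarrow> (nat \<times> nat, 'k::comm_ring_1) mpoly fps"
  where "evaluated_arc i p = Abs_fps (\<lambda>l. mconst (of_nat p ^ l) * mvar (i, l))"

lemma evaluated_arc_coeffs_in: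
  assumes "i \<in> {1..n}"
  shows "evaluated_arc i p \<in> coeffs_in {p :: (nat \<times> nat, 'k::comm_ring_1) mpoly. mvars p \<subseteq> arc_vars n}"
proof -
  have "mvars (mconst c * mvar (i, l) :: (nat \<times> nat, 'k) mpoly) \<subseteq> arc_vars n" for c l
    using mvars_mult[of "mconst c" "mvar (i, l) :: (nat \<times> nat, 'k) mpoly"] assms
    by (auto simp: arc_vars_def)
  then show ?thesis
    by (simp add: coeffs_in_def evaluated_arc_def)
qed

text \<open>The coefficient of \<open>\<epsilon> ^ l\<close> in \<open>x\<^sub>i(p \<epsilon>) x\<^sub>j(p \<epsilon>)\<close> is \<open>p ^ l\<close> times the coefficient of \<open>t ^ l\<close> in
\<open>x\<^sub>i(t) x\<^sub>j(t)\<close>.\<close>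
lemma evaluated_arc_mult:
  assumes "i \<in> {1..n}" "j \<in> {1..n}"
  shows "evaluated_arc i p * evaluated_arc j p \<in>
    coeffs_in (fat_point_arc_ideal n :: (nat \<times> nat, 'k::comm_ring_1) mpoly set)"
proof -
  have "fps_nth (evaluated_arc i p * evaluated_arc j p) l =
      (mconst (of_nat p ^ l) * fps_nth (arc_series i * arc_series j) l
        :: (nat \<times> nat, 'k) mpoly)" for l
  proof -
    have "mconst (of_nat p ^ s) * mvar (i, s) * (mconst (of_nat p ^ (l - s)) * mvar (j, l - s)) =
        (mconst (of_nat p ^ l) * (mvar (i, s) * mvar (j, l - s)) :: (nat \<times> nat, 'k) mpoly)"
      if "s \<le> l" for s
    proof -
      have "(of_nat p ^ l :: 'k) = of_nat p ^ s * of_nat p ^ (l - s)"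
        using that by (simp flip: power_add)
      then show ?thesis
        by (simp only: mconst_mult mult_ac)
    qed
    then show ?thesis
      by (simp add: fps_mult_nth evaluated_arc_def arc_series_def sum_distrib_left)
  qed
  moreover have "mconst (of_nat p ^ l) * fps_nth (arc_series i * arc_series j) l \<in>
      (fat_point_arc_ideal n :: (nat \<times> nat, 'k) mpoly set)" for l
    by (intro fat_point_arc_ideal_closed(3) arc_product_in_fat_point_arc_ideal assms) simp
  ultimately show ?thesis
    by (simp add: coeffs_in_def)
qed

text \<open>At each point \<open>p\<close>, the factor is 1 or one of the values \<open>x\<^sub>1(p \<epsilon>), \<dots>, x\<^sub>n(p \<epsilon>)\<close>, according to \<open>s p\<close>.
These products correspond to the basis of the \<open>N\<close>-fold tensor power of \<open>k[y\<^sub>1, \<dots>, y\<^sub>n] / (y\<^sub>i y\<^sub>j)\<close>.\<close>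
definition point_product ::
    "nat \<Rightarrow> (nat \<Rightarrow> nat) \<Rightarrow> (nat \<times> nat, 'k::comm_ring_1) mpoly fps"
  where "point_product N s = (\<Prod>p<N. if s p = 0 then 1 else evaluated_arc (s p) p)"

abbreviation colourings :: "nat \<Rightarrow> nat \<Rightarrow> (nat \<Rightarrow> nat) set"
  where "colourings n N \<equiv> {..<N} \<rightarrow>\<^sub>E {0..n}"

text \<open>The power series that are congruent to a \<open>k[[\<epsilon>]]\<close>-linear combination of the products, modulo
the ideal of power series with coefficients in the arc ideal.\<close>
definition spanned_by_points :: "nat \<Rightarrow> nat \<Rightarrow> (nat \<times> nat, 'k::comm_ring_1) mpoly fps \<Rightarrow> bool"
  where "spanned_by_points n N F \<longleftrightarrow>
    (\<exists>a. F - (\<Sum>s\<in>colourings n N. scalar_series (a s) * point_product N s)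
       \<in> coeffs_in (fat_point_arc_ideal n))"

lemma spanned_by_points_arc_ideal:
  "F \<in> coeffs_in (fat_point_arc_ideal n) \<Longrightarrow> spanned_by_points n N F"
  unfolding spanned_by_points_def by (intro exI[of _ "\<lambda>_. 0"]) simp

lemma spanned_by_points_point_product:
  assumes "s \<in> colourings n N"
  shows "spanned_by_points n N (point_product N s :: (nat \<times> nat, 'k::comm_ring_1) mpoly fps)"
proof -
  let ?W = "\<lambda>t. point_product N t :: (nat \<times> nat, 'k) mpoly fps"
  have "finite (colourings n N)"
    by (intro finite_PiE) auto
  moreover have "scalar_series (if t = s then 1 else 0) * ?W t = (if t = s then ?W t else 0)" for t
    by simp
  ultimately have "(\<Sum>t\<in>colourings n N. scalar_series (if t = s then 1 else 0) * ?W t) = ?W s"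
    using assms by simp
  then show ?thesis
    unfolding spanned_by_points_def
    by (intro exI[of _ "\<lambda>t. if t = s then 1 else 0"])
       (simp add: coeffs_in_def fat_point_arc_ideal_closed(1))
qed

lemma spanned_by_points_add:
  assumes "spanned_by_points n N F" "spanned_by_points n N G"
  shows "spanned_by_points n N (F + G)"
proof -
  let ?\<Sigma> = "\<lambda>a. \<Sum>s\<in>colourings n N. scalar_series (a s) * point_product N s"
  obtain a b where ab: "F - ?\<Sigma> a \<in> coeffs_in (fat_point_arc_ideal n)"
      "G - ?\<Sigma> b \<in> coeffs_in (fat_point_arc_ideal n)"
    using assms unfolding spanned_by_points_def by blast
  have eq: "F + G - ?\<Sigma> (\<lambda>s. a s + b s) = (F - ?\<Sigma> a) + (G - ?\<Sigma> b)"
    by (simp add: scalar_series_add distrib_right sum.distrib)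
  then show ?thesis
    unfolding spanned_by_points_def using arc_ideal_series_closed(1)[OF ab]
    by (intro exI[of _ "\<lambda>s. a s + b s"]) (simp only: eq)
qed

lemma spanned_by_points_sum:
  "(\<And>x. x \<in> A \<Longrightarrow> spanned_by_points n N (f x)) \<Longrightarrow> spanned_by_points n N (sum f A)"
proof (induction A rule: infinite_finite_induct)
  case (insert x A)
  then show ?case by (simp add: spanned_by_points_add)
qed (simp_all add: spanned_by_points_arc_ideal coeffs_in_def fat_point_arc_ideal_closed(1))

lemma spanned_by_points_scalar:
  assumes "spanned_by_points n N F"
  shows "spanned_by_points n N (scalar_series b * F)"
proof -
  let ?\<Sigma> = "\<lambda>a. \<Sum>s\<in>colourings n N. scalar_series (a s) * point_product N s"
  obtain a where a: "F - ?\<Sigma> a \<in> coeffs_in (fat_point_arc_ideal n)"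
    using assms unfolding spanned_by_points_def by blast
  have eq: "scalar_series b * F - ?\<Sigma> (\<lambda>s. b * a s) = scalar_series b * (F - ?\<Sigma> a)"
    by (simp add: scalar_series_mult right_diff_distrib sum_distrib_left mult.assoc)
  then show ?thesis
    unfolding spanned_by_points_def
    using arc_ideal_series_closed(2)[OF scalar_series_coeffs_in a]
    by (intro exI[of _ "\<lambda>s. b * a s"]) (simp only: eq)
qed

text \<open>If the factor at the point \<open>p\<close> is 1, it becomes \<open>x\<^sub>i(p \<epsilon>)\<close>; otherwise the product contains two values at
the same point and vanishes modulo the arc ideal.\<close>
lemma point_product_mult_evaluated_arc:
  assumes s: "s \<in> colourings n N" and i: "i \<in> {1..n}" and p: "p < N"
  shows "spanned_by_points n N
    (point_product N s * evaluated_arc i p :: (nat \<times> nat, 'k::comm_ring_1) mpoly fps)"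
proof -
  let ?f = "\<lambda>s p. if s p = 0 then 1 else evaluated_arc (s p) p :: (nat \<times> nat, 'k) mpoly fps"
  have split: "point_product N t = ?f t p * (\<Prod>q\<in>{..<N} - {p}. ?f t q)" for t
    unfolding point_product_def using p by (intro prod.remove) simp_all
  show ?thesis
  proof (cases "s p = 0")
    case True
    have "(\<Prod>q\<in>{..<N} - {p}. ?f (s(p := i)) q) = (\<Prod>q\<in>{..<N} - {p}. ?f s q)"
      by (rule prod.cong) auto
    then have "point_product N s * evaluated_arc i p =
        (point_product N (s(p := i)) :: (nat \<times> nat, 'k) mpoly fps)"
      unfolding split using True i by (simp only: mult.commute fun_upd_same) simp
    moreover have "s(p := i) \<in> colourings n N"
      using s i p by (auto simp: PiE_iff extensional_def)
    ultimately show ?thesis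
      by (simp add: spanned_by_points_point_product)
  next
    case False
    have range: "s q \<in> {1..n}" if "q < N" "s q \<noteq> 0" for q
      using PiE_mem[OF s, of q] that by simp
    have "(\<Prod>q\<in>{..<N} - {p}. ?f s q) \<in> coeffs_in {p. mvars p \<subseteq> arc_vars n}"
    proof (rule coeffs_in_vars_prod)
      fix q assume "q \<in> {..<N} - {p}"
      then show "?f s q \<in> coeffs_in {p. mvars p \<subseteq> arc_vars n}"
        using evaluated_arc_coeffs_in[OF range, of q q] by (auto simp: coeffs_in_def)
    qed
    then have "(\<Prod>q\<in>{..<N} - {p}. ?f s q) * (evaluated_arc (s p) p * evaluated_arc i p)
        \<in> coeffs_in (fat_point_arc_ideal n)"
      by (rule arc_ideal_series_closed(2)) (rule evaluated_arc_mult[OF range[OF p False] i])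
    then show ?thesis
      unfolding split using False by (intro spanned_by_points_arc_ideal) (simp add: mult_ac)
  qed
qed

lemma spanned_by_points_mult_evaluated_arc:
  assumes "spanned_by_points n N F" "i \<in> {1..n}" "p < N"
  shows "spanned_by_points n N (F * evaluated_arc i p)"
proof -
  let ?\<Sigma> = "\<lambda>a. \<Sum>s\<in>colourings n N. scalar_series (a s) * point_product N s"
  obtain a where a: "F - ?\<Sigma> a \<in> coeffs_in (fat_point_arc_ideal n)"
    using assms(1) unfolding spanned_by_points_def by blast
  have "F * evaluated_arc i p = evaluated_arc i p * (F - ?\<Sigma> a) +
      (\<Sum>s\<in>colourings n N. scalar_series (a s) * (point_product N s * evaluated_arc i p))"
    by (simp add: right_diff_distrib sum_distrib_left mult_ac)
  moreover have "spanned_by_points n N (evaluated_arc i p * (F - ?\<Sigma> a))"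
    using arc_ideal_series_closed(2)[OF evaluated_arc_coeffs_in[OF assms(2)] a]
    by (rule spanned_by_points_arc_ideal)
  moreover have "spanned_by_points n N
      (\<Sum>s\<in>colourings n N. scalar_series (a s) * (point_product N s * evaluated_arc i p))"
    by (intro spanned_by_points_sum spanned_by_points_scalar
        point_product_mult_evaluated_arc assms(2,3))
  ultimately show ?thesis
    by (simp only: spanned_by_points_add)
qed

lemma monomial_value_nth_0: "fps_nth (monomial_value x m) 0 = monomial_value (\<lambda>v. fps_nth (x v) 0) m"
  for x :: "'v \<Rightarrow> 'a::comm_ring_1 fps"
proof -
  have "fps_nth (\<Prod>v\<in>A. f v) 0 = (\<Prod>v\<in>A. fps_nth (f v) 0)" for A :: "'v set" and f :: "'v \<Rightarrow> 'a fps"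
    by (induction A rule: infinite_finite_induct) simp_all
  then show ?thesis
    by (simp add: monomial_value_def fps_power_zeroth)
qed

text \<open>The deformed variables \<open>Y\<close> satisfy \<open>Y = x + O(\<epsilon>)\<close>, while \<open>X = \<epsilon> ^ j Y\<close> is a constant linear
combination of the values of an arc at the \<open>N\<close> points. A power of \<open>\<epsilon>\<close> times the value of a polynomial at
\<open>Y\<close> is therefore spanned by \<open>(n + 1) ^ N\<close> products, and more polynomials than that satisfy a relation over
\<open>k[[\<epsilon>]]\<close>. Its lowest coefficient is the desired relation.\<close>
lemma linearly_dependent_mod_arc_ideal:
  fixes G :: "'r \<Rightarrow> (nat \<times> nat, 'k::field_char_0) mpoly"
  assumes "finite T" "(n + 1) ^ Suc h < card T" and vars: "\<And>r. r \<in> T \<Longrightarrow> mvars (G r) \<subseteq> jet_vars n h"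
  shows "\<exists>c. (\<exists>r\<in>T. c r \<noteq> 0) \<and> (\<Sum>r\<in>T. mconst (c r) * G r) \<in> fat_point_arc_ideal n"
proof -
  define N where "N = Suc h"
  let ?S = "colourings n N"
  let ?I = "coeffs_in (fat_point_arc_ideal n) :: (nat \<times> nat, 'k) mpoly fps set"
  obtain b :: "nat \<Rightarrow> nat \<Rightarrow> 'k" where b:
    "\<And>j m. m < N \<Longrightarrow> (\<Sum>p<N. b j p * of_nat p ^ m) = (if j = m then 1 else 0)"
    using inverse_vandermonde[of N] by blast
  define X :: "nat \<times> nat \<Rightarrow> (nat \<times> nat, 'k) mpoly fps"
    where "X v = (\<Sum>p<N. scalar_series (fps_const (b (snd v) p)) * evaluated_arc (fst v) p)" for v
  define Y where "Y v = fps_shift (snd v) (X v)" for v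
  have X_nth: "fps_nth (X v) m = mconst (\<Sum>p<N. b (snd v) p * of_nat p ^ m) * mvar (fst v, m)" for v m
    unfolding X_def fps_sum_nth mconst_sum sum_distrib_right
    by (rule sum.cong) (simp_all add: evaluated_arc_def scalar_series_const mconst_mult mult_ac)
  have less_N: "snd v < N" if "v \<in> jet_vars n h" for v
    using that by (auto simp: jet_vars_def N_def)
  have X_Y: "X v = fps_X ^ snd v * Y v" if "v \<in> jet_vars n h" for v
  proof (rule fps_ext)
    fix m
    show "fps_nth (X v) m = fps_nth (fps_X ^ snd v * Y v) m"
      using less_N[OF that] by (auto simp: fps_X_power_mult_nth Y_def X_nth b)
  qed
  have Y_0: "fps_nth (Y v) 0 = mvar v" if "v \<in> jet_vars n h" for v
    using less_N[OF that] by (simp add: Y_def X_nth b)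
  have mult_X: "spanned_by_points n N (F * X v)" 
    if "spanned_by_points n N F" "v \<in> jet_vars n h" for F v
  proof -
    have "F * X v = (\<Sum>p<N. scalar_series (fps_const (b (snd v) p)) * (F * evaluated_arc (fst v) p))"
      by (simp add: X_def sum_distrib_left mult_ac)
    then show ?thesis
      using that
      by (auto simp: jet_vars_def intro!: spanned_by_points_sum spanned_by_points_scalar
          spanned_by_points_mult_evaluated_arc)
  qed
  have mult_power: "spanned_by_points n N (F * X v ^ k)"
    if "spanned_by_points n N F" "v \<in> jet_vars n h" for F v k
    using that by (induction k) (simp_all add: mult.assoc[symmetric] mult_X power_Suc2 del: power_Suc)
  have one: "spanned_by_points n N (1 :: (nat \<times> nat, 'k) mpoly fps)"
  proof -
    \<comment> \<open>The constant colouring 0 gives the empty product.\<close>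
    have "point_product N (restrict (\<lambda>_. 0) {..<N}) = (1 :: (nat \<times> nat, 'k) mpoly fps)"
      unfolding point_product_def by (intro prod.neutral) simp
    moreover have "restrict (\<lambda>_. 0) {..<N} \<in> ?S"
      by auto
    ultimately show ?thesis
      using spanned_by_points_point_product by metis
  qed
  have "spanned_by_points n N (\<Prod>v\<in>A. X v ^ e v)" if "A \<subseteq> jet_vars n h" for A and e :: "nat \<times> nat \<Rightarrow> nat"
    using that
    by (induction A rule: infinite_finite_induct)
       (auto simp: one mult.commute[of "X _ ^ _"] intro: mult_power)
  then have spanned: "spanned_by_points n N (monomial_value X m)"
    if "Poly_Mapping.keys m \<subseteq> jet_vars n h" for m
    using that by (simp add: monomial_value_def)
  define ev where "ev F =
    (\<Sum>m\<in>Poly_Mapping.keys F. fps_const (mconst (Poly_Mapping.lookup F m)) * monomial_value Y m)"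
    for F :: "(nat \<times> nat, 'k) mpoly"
  have keys: "Poly_Mapping.keys m \<subseteq> jet_vars n h" if "m \<in> Poly_Mapping.keys (G r)" "r \<in> T" for m r
    using vars[OF that(2)] that(1) by (auto simp: mvars_def)
  have ev_0: "fps_nth (ev (G r)) 0 = G r" if "r \<in> T" for r
  proof -
    have "monomial_value (\<lambda>v. fps_nth (Y v) 0) m = monomial_value mvar m"
      if "m \<in> Poly_Mapping.keys (G r)" for m
      unfolding monomial_value_def using keys[OF that \<open>r \<in> T\<close>] Y_0
      by (intro prod.cong) auto
    then have "fps_nth (ev (G r)) 0 =
        (\<Sum>m\<in>Poly_Mapping.keys (G r). mconst (Poly_Mapping.lookup (G r) m) * monomial_value mvar m)"
      by (simp add: ev_def fps_sum_nth monomial_value_nth_0)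
    then show ?thesis
      unfolding monomial_value_mvar by (simp flip: mpoly_eq_sum_monomials)
  qed
  define wt where "wt m = (\<Sum>v\<in>Poly_Mapping.keys m. snd v * Poly_Mapping.lookup m v)"
    for m :: "nat \<times> nat \<Rightarrow>\<^sub>0 nat"
  \<comment> \<open>Any common upper bound of the weights serves as exponent \<open>K\<close>; the sum is one.\<close>
  define K where "K = (\<Sum>r\<in>T. \<Sum>m\<in>Poly_Mapping.keys (G r). wt m)"
  have "spanned_by_points n N (fps_X ^ K * ev (G r))" if "r \<in> T" for r
  proof -
    have "fps_X ^ K * (fps_const (mconst c) * monomial_value Y m) =
        scalar_series (fps_X ^ (K - wt m) * fps_const c) * monomial_value X m"
      if m: "m \<in> Poly_Mapping.keys (G r)" for m c
    proof -
      have "wt m \<le> (\<Sum>m\<in>Poly_Mapping.keys (G r). wt m)"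
        using m by (intro member_le_sum) auto
      also have "\<dots> \<le> K"
        unfolding K_def using \<open>r \<in> T\<close> assms(1)
        by (intro member_le_sum[of r T "\<lambda>r. \<Sum>m\<in>Poly_Mapping.keys (G r). wt m"]) auto
      finally have K: "K = (K - wt m) + wt m" by simp
      have "monomial_value X m =
          (\<Prod>v\<in>Poly_Mapping.keys m. (fps_X ^ snd v * Y v) ^ Poly_Mapping.lookup m v)"
        unfolding monomial_value_def using keys[OF m \<open>r \<in> T\<close>] X_Y by (intro prod.cong) auto
      also have "\<dots> = fps_X ^ wt m * monomial_value Y m"
        by (simp add: power_mult_distrib prod.distrib monomial_value_def wt_def power_sum power_mult)
      finally show ?thesis
        by (subst K) (simp add: power_add scalar_series_mult scalar_series_X_power
            scalar_series_const mult_ac)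
    qed
    then have "fps_X ^ K * ev (G r) = (\<Sum>m\<in>Poly_Mapping.keys (G r).
        scalar_series (fps_X ^ (K - wt m) * fps_const (Poly_Mapping.lookup (G r) m)) * monomial_value X m)"
      unfolding ev_def sum_distrib_left by (intro sum.cong) auto
    then show ?thesis
      using keys[OF _ that]
      by (auto intro!: spanned_by_points_sum spanned_by_points_scalar spanned)
  qed
  then have "\<forall>r\<in>T. \<exists>a. fps_X ^ K * ev (G r) -
      (\<Sum>s\<in>?S. scalar_series (a s) * point_product N s) \<in> ?I"
    unfolding spanned_by_points_def by blast
  from bchoice[OF this] obtain a where a: "\<And>r. r \<in> T \<Longrightarrow>
      fps_X ^ K * ev (G r) - (\<Sum>s\<in>?S. scalar_series (a r s) * point_product N s) \<in> ?I"
    by blast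
  have "finite ?S" "card ?S = (n + 1) ^ N"
    by (auto simp: card_funcsetE intro: finite_PiE)
  then have "finite ?S" "card ?S < card T"
    using assms(2) by (simp_all add: N_def)
  then obtain c where c: "\<exists>r\<in>T. fps_nth (c r) 0 \<noteq> 0" "\<forall>s\<in>?S. (\<Sum>r\<in>T. c r * a r s) = 0"
    using linearly_dependent_power_series[of ?S T a] assms(1) by blast
  have "(\<Sum>r\<in>T. \<Sum>s\<in>?S. scalar_series (c r) * (scalar_series (a r s) * point_product N s)) =
      (\<Sum>s\<in>?S. scalar_series (\<Sum>r\<in>T. c r * a r s) * point_product N s :: (nat \<times> nat, 'k) mpoly fps)"
    by (subst sum.swap) (simp add: scalar_series_sum scalar_series_mult sum_distrib_right mult.assoc)
  also have "\<dots> = 0"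
    by (intro sum.neutral ballI) (simp only: c(2)[rule_format] scalar_series_0 mult_zero_left)
  finally have cancel: "(\<Sum>r\<in>T. scalar_series (c r) *
      (\<Sum>s\<in>?S. scalar_series (a r s) * point_product N s)) = (0 :: (nat \<times> nat, 'k) mpoly fps)"
    unfolding sum_distrib_left .
  have "fps_X ^ K * (\<Sum>r\<in>T. scalar_series (c r) * ev (G r)) =
      (\<Sum>r\<in>T. scalar_series (c r) *
        (fps_X ^ K * ev (G r) - (\<Sum>s\<in>?S. scalar_series (a r s) * point_product N s)))"
    by (simp only: right_diff_distrib sum_subtractf cancel) (simp add: sum_distrib_left mult_ac)
  also have "\<dots> \<in> ?I"
    by (intro coeffs_in_sum fat_point_arc_ideal_closed arc_ideal_series_closed(2)
        scalar_series_coeffs_in a)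
  finally have "fps_nth (fps_X ^ K * (\<Sum>r\<in>T. scalar_series (c r) * ev (G r))) K \<in> fat_point_arc_ideal n"
    by (simp add: coeffs_in_def)
  also have "fps_nth (fps_X ^ K * (\<Sum>r\<in>T. scalar_series (c r) * ev (G r))) K =
      (\<Sum>r\<in>T. mconst (fps_nth (c r) 0) * G r)"
    by (simp add: fps_X_power_mult_nth fps_sum_nth ev_0)
  finally show ?thesis
    using c(1) by (intro exI[of _ "\<lambda>r. fps_nth (c r) 0"]) blast
qed

section \<open>The dimension of the quotient\<close>

text \<open>The quotient inherits this subfield as the image of the constants, and its dimension is taken over that
image.\<close>
lemma subfield_constants: "subfield (range mconst) (poly_ring V :: ('v, 'k::field) mpoly ring)"
proof -
  interpret cring "poly_ring V :: ('v, 'k) mpoly ring"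
    by (rule poly_ring_cring)
  let ?K = "range mconst :: ('v, 'k) mpoly set"
  have inj: "inj (mconst :: 'k \<Rightarrow> ('v, 'k) mpoly)"
    unfolding mconst_def by (metis injI lookup_single_eq)
  have one: "1 \<in> ?K"
    using rangeI[of mconst 1] by simp
  have "subring ?K (poly_ring V)"
    by (rule subringI)
       (auto simp: poly_ring_a_inv one mconst_uminus[symmetric] mconst_add[symmetric] mconst_mult[symmetric])
  moreover have "Units (poly_ring V \<lparr>carrier := ?K\<rparr>) = ?K - {\<zero>\<^bsub>poly_ring V\<^esub>}"
  proof
    show "Units (poly_ring V \<lparr>carrier := ?K\<rparr>) \<subseteq> ?K - {\<zero>\<^bsub>poly_ring V\<^esub>}"
      using injD[OF inj, of 1 0] by (auto simp: Units_def)
    have "mconst c \<in> Units (poly_ring V \<lparr>carrier := ?K\<rparr>)" if "c \<noteq> 0" for c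
      using that unfolding Units_def
      by (auto intro!: exI[of _ "inverse c"] simp: mconst_mult[symmetric])
    moreover have "c \<noteq> 0" if "mconst c \<noteq> (0 :: ('v, 'k) mpoly)" for c
      using that by auto
    ultimately show "?K - {\<zero>\<^bsub>poly_ring V\<^esub>} \<subseteq> Units (poly_ring V \<lparr>carrier := ?K\<rparr>)"
      by auto
  qed
  ultimately show ?thesis
    by (intro subfieldI subcringI')
qed

lemma combine_constants:
  fixes Us :: "('v, 'k::field) mpoly list"
  shows "ring.combine (poly_ring V) (map mconst cs) Us =
    (\<Sum>i<length Us. mconst (if i < length cs then cs ! i else 0) * Us ! i)"
proof -
  interpret cring "poly_ring V :: ('v, 'k) mpoly ring"
    by (rule poly_ring_cring)
  show ?thesis
  proof (induction Us arbitrary: cs)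
    case (Cons u Us)
    then show ?case
      by (cases cs) (simp_all add: sum.lessThan_Suc_shift del: sum.lessThan_Suc cong: if_cong)
  qed simp
qed

text \<open>Combinations in the quotient are images of combinations of polynomials, so a basis of the quotient can be
described by membership in \<open>J\<close> alone.\<close>
lemma quot_dim_eq_length_basis:
  fixes J :: "('v, 'k::field) mpoly set"
  assumes "ideal J (poly_ring V)" and "1 \<notin> J"
    and vars: "\<And>u. u \<in> set Us \<Longrightarrow> mvars u \<subseteq> V"
    and spanning: "\<And>F. mvars F \<subseteq> V \<Longrightarrow> \<exists>c. F - (\<Sum>i<length Us. mconst (c i) * Us ! i) \<in> J"
    and independent: "\<And>c i. (\<Sum>i<length Us. mconst (c i) * Us ! i) \<in> J \<Longrightarrow> i < length Us \<Longrightarrow> c i = 0"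
  shows "quot_dim V J = length Us"
proof -
  let ?R = "poly_ring V :: ('v, 'k) mpoly ring"
  let ?h = "\<lambda>p. J +>\<^bsub>?R\<^esub> p"
  interpret R: cring ?R
    by (rule poly_ring_cring)
  interpret J: ideal J ?R
    by (rule assms(1))
  interpret Q: ring "?R Quot J"
    by (rule J.quotient_is_ring)
  interpret h: ring_hom_ring ?R "?R Quot J" ?h
    by (rule J.rcos_ring_hom_ring)
  have zero: "\<zero>\<^bsub>?R Quot J\<^esub> = J" and one: "\<one>\<^bsub>?R Quot J\<^esub> = ?h 1"
    by (simp_all add: FactRing_def)
  have h_zero: "?h p = J \<longleftrightarrow> p \<in> J" if "mvars p \<subseteq> V" for p
    using that J.a_rcos_const[of p] J.a_rcos_self[of p] by auto
  have Us: "set Us \<subseteq> carrier ?R"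
    using vars by auto
  have comb_vars: "mvars (\<Sum>i<length Us. mconst (c i) * Us ! i) \<subseteq> V" for c
  proof (rule mvars_sum)
    fix i assume "i \<in> {..<length Us}"
    then show "mvars (mconst (c i) * Us ! i) \<subseteq> V"
      using mvars_mult[of "mconst (c i)" "Us ! i"] vars[of "Us ! i"] by auto
  qed
  define K where "K = range (\<lambda>c. ?h (mconst c))"
  have K_eq: "K = ?h ` range mconst"
    by (auto simp: K_def)
  have K: "subfield K (?R Quot J)"
    unfolding K_eq
    by (rule h.img_is_subfield(2)[OF subfield_constants]) (use h_zero[of 1] assms(2) in \<open>auto simp: zero one\<close>)
  have combine: "Q.combine (map (\<lambda>c. ?h (mconst c)) cs) (map ?h Us) =
      ?h (\<Sum>i<length Us. mconst (if i < length cs then cs ! i else 0) * Us ! i)" for cs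
    using h.combine_hom[of "map mconst cs" Us] Us combine_constants[of V cs Us]
    by (simp add: comp_def image_subset_iff)
  have "Q.independent K (map ?h Us)"
  proof (rule Q.trivial_combine_imp_independent[OF K])
    show "set (map ?h Us) \<subseteq> carrier (?R Quot J)"
      using Us h.hom_closed by auto
  next
    fix Ks assume "set Ks \<subseteq> K" and comb: "Q.combine Ks (map ?h Us) = \<zero>\<^bsub>?R Quot J\<^esub>"
    then have "Ks \<in> lists (range (\<lambda>c. ?h (mconst c)))"
      by (simp add: K_def in_lists_conv_set subset_iff)
    then obtain cs where cs: "Ks = map (\<lambda>c. ?h (mconst c)) cs"
      unfolding lists_image by blast
    have "(\<Sum>i<length Us. mconst (if i < length cs then cs ! i else 0) * Us ! i) \<in> J"
      using comb comb_vars unfolding cs combine zero by (subst (asm) h_zero)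
    then have coeff: "cs ! i = 0" if "i < length Us" "i < length cs" for i
      using independent[of "\<lambda>i. if i < length cs then cs ! i else 0" i] that by simp
    have "x = \<zero>\<^bsub>?R Quot J\<^esub>" if x: "x \<in> set (take (length Us) Ks)" for x
    proof -
      obtain c where "c \<in> set (take (length Us) cs)" "x = ?h (mconst c)"
        using x by (auto simp: cs take_map)
      moreover from this(1) have "c = 0"
        using coeff by (auto simp: in_set_conv_nth)
      ultimately show ?thesis
        using h_zero[of 0] additive_subgroup.zero_closed[OF J.is_additive_subgroup]
        by (simp add: zero)
    qed
    then show "set (take (length (map ?h Us)) Ks) \<subseteq> {\<zero>\<^bsub>?R Quot J\<^esub>}"
      by auto
  qed
  moreover have "Q.Span K (map ?h Us) = carrier (?R Quot J)"
  proof
    show "Q.Span K (map ?h Us) \<subseteq> carrier (?R Quot J)"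
      using Us h.hom_closed by (intro Q.Span_subgroup_props(1)[OF K]) auto
    show "carrier (?R Quot J) \<subseteq> Q.Span K (map ?h Us)"
    proof
      fix x assume "x \<in> carrier (?R Quot J)"
      then obtain F where F: "mvars F \<subseteq> V" "x = ?h F"
        by (auto simp: FactRing_def A_RCOSETS_def')
      obtain c where c: "F - (\<Sum>i<length Us. mconst (c i) * Us ! i) \<in> J"
        using spanning[OF F(1)] by blast
      let ?G = "\<Sum>i<length Us. mconst (c i) * Us ! i"
      have "?h F = ?h ((F - ?G) \<oplus>\<^bsub>?R\<^esub> ?G)"
        by simp
      also have "\<dots> = ?h (F - ?G) \<oplus>\<^bsub>?R Quot J\<^esub> ?h ?G"
        using J.Icarr[OF c] comb_vars[of c] by (intro h.hom_add) auto
      also have "\<dots> = ?h ?G"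
      proof -
        have "?h (F - ?G) = \<zero>\<^bsub>?R Quot J\<^esub>"
          unfolding zero by (rule J.a_rcos_const[OF c])
        moreover have "?h ?G \<in> carrier (?R Quot J)"
          using comb_vars[of c] by (intro h.hom_closed) simp
        ultimately show ?thesis
          by (simp only: Q.l_zero)
      qed
      also have "\<dots> = Q.combine (map (\<lambda>c. ?h (mconst c)) (map c [0..<length Us])) (map ?h Us)"
        unfolding combine by (intro arg_cong[where f = ?h] sum.cong) auto
      finally have "x = Q.combine (map (\<lambda>c. ?h (mconst c)) (map c [0..<length Us])) (map ?h Us)"
        unfolding F(2) .
      moreover have "set (map (\<lambda>c. ?h (mconst c)) (map c [0..<length Us])) \<subseteq> K"
        by (auto simp: K_def)
      moreover have "length (map (\<lambda>c. ?h (mconst c)) (map c [0..<length Us])) = length (map ?h Us)"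
        by simp
      moreover have "set (map ?h Us) \<subseteq> carrier (?R Quot J)"
        using Us h.hom_closed by auto
      ultimately show "x \<in> Q.Span K (map ?h Us)"
        unfolding Q.Span_mem_iff_length_version[OF K \<open>set (map ?h Us) \<subseteq> carrier (?R Quot J)\<close>]
        by blast
    qed
  qed
  ultimately have "Q.dimension (length (map ?h Us)) K (carrier (?R Quot J))"
    by (rule Q.dimensionI[OF K])
  then have "Q.dim K (carrier (?R Quot J)) = length Us"
    using Q.dimI[OF K] by (simp add: over_def)
  then show ?thesis
    by (simp add: quot_dim_def K_def)
qed

lemma quot_dim_eq_card_basis:
  fixes J :: "('v, 'k::field) mpoly set" and U :: "'w \<Rightarrow> ('v, 'k) mpoly"
  assumes "ideal J (poly_ring V)" and "1 \<notin> J" and "finite B"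
    and "\<And>w. w \<in> B \<Longrightarrow> mvars (U w) \<subseteq> V"
    and spanning: "\<And>F. mvars F \<subseteq> V \<Longrightarrow> \<exists>c. F - (\<Sum>w\<in>B. mconst (c w) * U w) \<in> J"
    and independent: "\<And>c w. (\<Sum>w\<in>B. mconst (c w) * U w) \<in> J \<Longrightarrow> w \<in> B \<Longrightarrow> c w = 0"
  shows "quot_dim V J = card B"
proof -
  obtain ws where ws: "set ws = B" "distinct ws"
    using finite_distinct_list[OF assms(3)] by blast
  have bij: "bij_betw ((!) ws) {..<length ws} B"
    using ws by (intro bij_betw_nth) auto
  define index where "index = the_inv_into {..<length ws} ((!) ws)"
  have index: "index (ws ! i) = i" if "i < length ws" for i
    unfolding index_def using bij that by (intro the_inv_into_f_f) (auto simp: bij_betw_def)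
  have reindex: "(\<Sum>i<length ws. mconst (c (ws ! i)) * map U ws ! i) = (\<Sum>w\<in>B. mconst (c w) * U w)"
    for c
    by (subst sum.reindex_bij_betw[OF bij, symmetric]) simp
  have "quot_dim V J = length (map U ws)"
  proof (rule quot_dim_eq_length_basis[OF assms(1,2)])
    fix u assume "u \<in> set (map U ws)"
    then show "mvars u \<subseteq> V"
      using assms(4) ws(1) by auto
  next
    fix F :: "('v, 'k) mpoly" assume "mvars F \<subseteq> V"
    then obtain c where "F - (\<Sum>w\<in>B. mconst (c w) * U w) \<in> J"
      using spanning by blast
    then show "\<exists>c. F - (\<Sum>i<length (map U ws). mconst (c i) * map U ws ! i) \<in> J"
      by (intro exI[of _ "\<lambda>i. c (ws ! i)"]) (simp only: length_map reindex)
  next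
    fix c i assume c: "(\<Sum>i<length (map U ws). mconst (c i) * map U ws ! i) \<in> J"
      and i: "i < length (map U ws)"
    have "(\<Sum>i<length (map U ws). mconst (c i) * map U ws ! i) =
        (\<Sum>i<length ws. mconst (c (index (ws ! i))) * map U ws ! i)"
      by (rule sum.cong) (simp_all add: index)
    also have "\<dots> = (\<Sum>w\<in>B. mconst (c (index w)) * U w)"
      by (rule reindex)
    finally have "c (index (ws ! i)) = 0"
      using c i ws(1) by (intro independent[of "\<lambda>w. c (index w)"]) auto
    then show "c i = 0"
      using i by (simp add: index)
  qed
  also have "\<dots> = card B"
    using ws distinct_card by fastforce
  finally show ?thesis .
qed

text \<open>The normal words are linearly independent modulo the arc ideal, and their number is the largest
possible one. So adding any polynomial to them produces a relation in which that polynomial has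
a nonzero coefficient: the normal words also span.\<close>
lemma quot_dim_jets:
  "quot_dim (jet_vars n h)
     ((fat_point_arc_ideal n :: (nat \<times> nat, 'k::field_char_0) mpoly set)
        \<inter> carrier (poly_ring (jet_vars n h))) = (n + 1) ^ Suc h"
proof -
  let ?I = "fat_point_arc_ideal n :: (nat \<times> nat, 'k) mpoly set"
  let ?V = "jet_vars n h"
  let ?B = "normal_words n h n 0 (Suc h)"
  define U :: "(nat \<times> nat) list \<Rightarrow> (nat \<times> nat, 'k) mpoly"
    where "U w = Poly_Mapping.single (word_monomial w) 1" for w
  have V: "?V \<subseteq> arc_vars n"
    by (auto simp: jet_vars_def arc_vars_def)
  have U_vars: "mvars (U w) \<subseteq> ?V" if "w \<in> ?B" for w
  proof
    fix v assume "v \<in> mvars (U w)"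
    then have "Poly_Mapping.lookup (word_monomial w) v \<noteq> 0"
      by (auto simp: U_def mvars_def in_keys_iff)
    then obtain r where "r < length w" "w ! r = v"
      by (auto simp: lookup_index_monomial card_eq_0_iff)
    then show "v \<in> ?V"
      using normal_words_nth[OF that, of r] by (auto simp: jet_vars_def)
  qed
  have scale: "mconst c * U w = Poly_Mapping.single (word_monomial w) c" for c w
    by (simp add: U_def mconst_def mult_single)
  have independent: "c w = 0" if "(\<Sum>w\<in>?B. mconst (c w) * U w) \<in> ?I" "w \<in> ?B" for c w
    using normal_words_independent[of c n h w] that by (simp add: scale)
  have card_B: "card ?B = (n + 1) ^ Suc h"
    using card_normal_words[of n n 0 "Suc h" h] by simp
  have "quot_dim ?V (?I \<inter> carrier (poly_ring ?V)) = card ?B"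
  proof (rule quot_dim_eq_card_basis[where U = U])
    show "ideal (?I \<inter> carrier (poly_ring ?V)) (poly_ring ?V)"
    proof (rule ideal_poly_ringI)
      fix p q :: "(nat \<times> nat, 'k) mpoly"
      assume "p \<in> ?I \<inter> carrier (poly_ring ?V)" "q \<in> ?I \<inter> carrier (poly_ring ?V)"
      then show "p + q \<in> ?I \<inter> carrier (poly_ring ?V)"
        using mvars_add[of p q] fat_point_arc_ideal_closed(2)[of p n q] by auto
    next
      fix a p :: "(nat \<times> nat, 'k) mpoly"
      assume "mvars a \<subseteq> ?V" "p \<in> ?I \<inter> carrier (poly_ring ?V)"
      then show "a * p \<in> ?I \<inter> carrier (poly_ring ?V)"
        using mvars_mult[of a p] fat_point_arc_ideal_closed(3)[of a n p] V by auto
    qed (auto intro: fat_point_arc_ideal_closed(1))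
    show "1 \<notin> ?I \<inter> carrier (poly_ring ?V)"
    proof
      \<comment> \<open>The empty determinant is evaluation at the origin.\<close>
      assume "1 \<in> ?I \<inter> carrier (poly_ring ?V)"
      then have "alternating_functional id id 0 (1 :: (nat \<times> nat, 'k) mpoly) = 0"
        by (intro alternating_functional_fat_point_arc_ideal) simp
      then show False
        by (simp add: alternating_functional_def deriv_at_0_def index_monomial_def sign_id)
    qed
    show "finite ?B"
      by (rule finite_normal_words)
    show "mvars (U w) \<subseteq> ?V" if "w \<in> ?B" for w
      using U_vars that .
    show "c w = 0" if "(\<Sum>w\<in>?B. mconst (c w) * U w) \<in> ?I \<inter> carrier (poly_ring ?V)" "w \<in> ?B"
      for c w
      using independent that by blast
  next
    fix F :: "(nat \<times> nat, 'k) mpoly" assume F: "mvars F \<subseteq> ?V"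
    \<comment> \<open>The index \<open>None\<close> stands for the additional polynomial \<open>F\<close>.\<close>
    let ?T = "insert None (Some ` ?B)"
    let ?G = "case_option F U"
    have T: "finite ?T" "card ?T = Suc (card ?B)"
      using finite_normal_words[of n h n 0 "Suc h"] by (simp_all add: card_image)
    have "mvars (?G r) \<subseteq> ?V" if "r \<in> ?T" for r
      using that F by (auto dest: subsetD[OF U_vars])
    then have "\<exists>c. (\<exists>r\<in>?T. c r \<noteq> 0) \<and> (\<Sum>r\<in>?T. mconst (c r) * ?G r) \<in> ?I"
      by (intro linearly_dependent_mod_arc_ideal T(1)) (unfold T(2) card_B, rule lessI)
    then obtain c where c: "\<exists>r\<in>?T. c r \<noteq> 0" "(\<Sum>r\<in>?T. mconst (c r) * ?G r) \<in> ?I"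
      by blast
    have sum: "(\<Sum>r\<in>?T. mconst (c r) * ?G r) =
        mconst (c None) * F + (\<Sum>w\<in>?B. mconst (c (Some w)) * U w)"
      using finite_normal_words[of n h n 0 "Suc h"] by (simp add: sum.reindex)
    have "c None \<noteq> 0"
    proof
      assume "c None = 0"
      then have "c (Some w) = 0" if "w \<in> ?B" for w
        using independent[of "\<lambda>w. c (Some w)"] c(2) sum that by simp
      then show False
        using c(1) \<open>c None = 0\<close> by auto
    qed
    let ?k = "inverse (c None)"
    have k: "mconst ?k * mconst (c None) = (1 :: (nat \<times> nat, 'k) mpoly)"
      using \<open>c None \<noteq> 0\<close> by (simp add: mconst_mult[symmetric])
    have "mconst ?k * (mconst (c None) * F + (\<Sum>w\<in>?B. mconst (c (Some w)) * U w)) \<in> ?I"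
      using c(2) unfolding sum by (intro fat_point_arc_ideal_closed(3)) auto
    also have "mconst ?k * (mconst (c None) * F + (\<Sum>w\<in>?B. mconst (c (Some w)) * U w)) =
        F - (\<Sum>w\<in>?B. mconst (- ?k * c (Some w)) * U w)"
      by (simp add: distrib_left mult.assoc[symmetric] k mconst_mult mconst_uminus sum_negf sum_distrib_left)
    finally have "F - (\<Sum>w\<in>?B. mconst (- ?k * c (Some w)) * U w) \<in> ?I" .
    moreover have "mvars (F - (\<Sum>w\<in>?B. mconst (- ?k * c (Some w)) * U w)) \<subseteq> ?V"
    proof -
      have "mvars (\<Sum>w\<in>?B. mconst (- ?k * c (Some w)) * U w) \<subseteq> ?V"
      proof (rule mvars_sum)
        fix w assume "w \<in> ?B"
        then show "mvars (mconst (- ?k * c (Some w)) * U w) \<subseteq> ?V"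
          using mvars_mult[of "mconst (- ?k * c (Some w))" "U w"] U_vars[of w] by auto
      qed
      then show ?thesis
        using F mvars_add[of F "- (\<Sum>w\<in>?B. mconst (- ?k * c (Some w)) * U w)"] by auto
    qed
    ultimately show "\<exists>c. F - (\<Sum>w\<in>?B. mconst (c w) * U w) \<in> ?I \<inter> carrier (poly_ring ?V)"
      by (intro exI[of _ "\<lambda>w. - ?k * c (Some w)"]) simp
  qed
  then show ?thesis
    by (simp only: card_B)
qed

theorem theorem3p3:
  fixes n :: nat
  assumes "n > 0"
  shows "Abs_fps (\<lambda>h. of_nat (quot_dim (jet_vars n h)
            ((arc_ideal n (fat_point_ideal n) :: (nat \<times> nat, 'k::field_char_0) mpoly set)
              \<inter> carrier (poly_ring (jet_vars n h)))))
         = (of_nat (n + 1) / (1 - of_nat (n + 1) * fps_X) :: rat fps)"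
proof -
  let ?c = "of_nat (n + 1) :: rat"
  let ?d = "1 - of_nat (n + 1) * fps_X :: rat fps"
  have "Abs_fps (\<lambda>h. ?c ^ Suc h) * ?d = of_nat (n + 1)"
  proof (rule fps_ext)
    fix h
    have c: "of_nat (n + 1) = fps_const ?c"
      by (simp only: fps_of_nat)
    show "fps_nth (Abs_fps (\<lambda>h. ?c ^ Suc h) * ?d) h = fps_nth (of_nat (n + 1)) h"
      unfolding c
      by (cases h) (simp_all add: right_diff_distrib mult.left_commute[of _ "fps_const _"])
  qed
  moreover have "fps_nth ?d 0 \<noteq> fps_nth 0 0"
    by simp
  then have "?d \<noteq> 0"
    by metis
  ultimately have "of_nat (n + 1) / ?d = Abs_fps (\<lambda>h. ?c ^ Suc h)"
    by (metis nonzero_mult_div_cancel_right)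
  then show ?thesis
    unfolding quot_dim_jets by (simp only: of_nat_power)
qed

end
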